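(* Assume $\ell(w,z)\in[0,1]$ for all $w,z$. Define $\bar L^+_i=\ell(W,\widetilde{Z}^{i,0}_{1,\overline{U}^{i,0}_1})$, $\bar L^-_i=\ell(W,\widetilde{Z}^{i,1}_{1,\overline{U}^{i,1}_1})$, $\Delta\bar L_i=\bar L^-_i-\bar L^+_i$, and $L^{i+}_j=\ell(W,\widetilde{Z}^{i,V_i}_{j,0})$, $L^{i-}_j=\ell(W,\widetilde{Z}^{i,V_i}_{j,1})$, $\Delta L^i_j=L^{i-}_j-L^{i+}_j$. Then $$|\mathcal{E}_{\mathcal{D}}(\mathcal{A})|\le\frac1K\sum_{i=1}^K\sqrt{2I(\Delta\bar L_i;V_i)}+\frac{1}{Kn}\sum_{i=1}^K\sum_{j=1}^n\mathbb{E}_{V_i}\sqrt{2I^{V_i}(\Delta L^i_j;U^{i,V_i}_j)}.$$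
   Context: Setting. $\mathcal{Z}$ is an instance space, $\mathcal{W}$ a hypothesis space, $\mathcal{C}$ a set of clients; each client $c\in\mathcal{C}$ has a data distribution $\mu_c$ on $\mathcal{Z}$, and $\mathcal{D}$ is a probability distribution on $\mathcal{C}$ (so a draw from $\mathcal{D}$ yields a data distribution on $\mathcal{Z}$). A loss $\ell:\mathcal{W}\times\mathcal{Z}\to[0,\infty)$ is given. There are $K$ participating clients, each with $n$ training points. A federated learning (FL) algorithm $\mathcal{A}$ is a conditional distribution $P_{W|S}$ mapping the collective training sample $S=(S_1,\dots,S_K)\in\mathcal{Z}^{nK}$ to a hypothesis $W\in\mathcal{W}$. Superclient/supersample construction. Let $\tilde\mu=(\tilde\mu_{i,b})_{i\in[K],b\in\{0,1\}}$ have i.i.d. entries drawn from $\mathcal{D}$. Conditionally on $\tilde\mu$, for each $(i,b)$ let $\widetilde{Z}^{i,b}=(\widetilde{Z}^{i,b}_{j,c})_{j\in[n],c\in\{0,1\}}$ have i.i.d. entries drawn from $\tilde\mu_{i,b}$, independently over $(i,b)$. Let $V=(V_1,\dots,V_K)$ and $U^{i,b}=(U^{i,b}_j)_{j\in[n]}$ ($i\in[K]$, $b\in\{0,1\}$) be mutually independent $\mathrm{Unif}\{0,1\}$ random variables, independent of $(\tilde\mu,\widetilde{Z})$. Write $\overline{V}_i=1-V_i$, $\overline{U}^{i,b}_j=1-U^{i,b}_j$. The $i$-th participating client distribution is $\mu_i=\tilde\mu_{i,V_i}$ and its training set is $S_i=(Z_{i,1},\dots,Z_{i,n})$ with $Z_{i,j}=\widetilde{Z}^{i,V_i}_{j,U^{i,V_i}_j}$;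 $S=(S_1,\dots,S_K)$. Given all of these variables, $W\sim P_{W|S}$. Risks. $L_{\mathcal{D}}(w)=\mathbb{E}_{\mu\sim\mathcal{D}}\mathbb{E}_{Z\sim\mu}\ell(w,Z)$; $L_S(w)=\frac{1}{Kn}\sum_{i=1}^K\sum_{j=1}^n\ell(w,Z_{i,j})$. Generalization error $\mathcal{E}_{\mathcal{D}}(\mathcal{A})=\mathbb{E}[L_{\mathcal{D}}(W)]-\mathbb{E}[L_S(W)]$. Information measures. $I(X;Y)$ is mutual information; the disintegrated mutual information is $I^{z}(X;Y)=\mathrm{D_{KL}}(P_{X,Y|Z=z}\,\|\,P_{X|Z=z}\otimes P_{Y|Z=z})$. *)

theory Defs
  imports "HOL-Probability.Probability"
begin

text \<open>Encoding conventions: the binary values 0 and 1 are encoded by False and True;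
  client indices i range over {..<K} (0-based), sample indices j over {..<n} (0-based).\<close>

definition coin :: "bool measure" where
  "coin = measure_pmf (bernoulli_pmf (1/2))"

text \<open>Index sets: (i,b) for the superclient distributions, (i,b,j,c) for the supersamples,
  (i,b,j) for the selectors U.\<close>
definition IM :: "nat \<Rightarrow> (nat \<times> bool) set" where
  "IM K = {..<K} \<times> UNIV"
definition IZ :: "nat \<Rightarrow> nat \<Rightarrow> (nat \<times> bool \<times> nat \<times> bool) set" where
  "IZ K n = {..<K} \<times> UNIV \<times> {..<n} \<times> UNIV"
definition IU :: "nat \<Rightarrow> nat \<Rightarrow> (nat \<times> bool \<times> nat) set" where
  "IU K n = {..<K} \<times> UNIV \<times> {..<n}"

definition sample_space :: "'z measure \<Rightarrow> nat \<Rightarrow> nat \<Rightarrow> (nat \<times> nat \<Rightarrow> 'z) measure" where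
  "sample_space Z K n = PiM ({..<K} \<times> {..<n}) (\<lambda>_. Z)"

definition sample ::
  "nat \<Rightarrow> nat \<Rightarrow> (nat \<times> bool \<times> nat \<times> bool \<Rightarrow> 'z) \<Rightarrow> (nat \<Rightarrow> bool) \<Rightarrow> (nat \<times> bool \<times> nat \<Rightarrow> bool)
     \<Rightarrow> (nat \<times> nat \<Rightarrow> 'z)" where
  "sample K n zt v u = (\<lambda>(i,j) \<in> {..<K} \<times> {..<n}. zt (i, v i, j, u (i, v i, j)))"

type_synonym ('c,'z,'w) omega =
  "(nat \<times> bool \<Rightarrow> 'c) \<times> (nat \<times> bool \<times> nat \<times> bool \<Rightarrow> 'z) \<times> (nat \<Rightarrow> bool)
     \<times> (nat \<times> bool \<times> nat \<Rightarrow> bool) \<times> 'w"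

definition omega_space ::
  "'c measure \<Rightarrow> 'z measure \<Rightarrow> 'w measure \<Rightarrow> nat \<Rightarrow> nat \<Rightarrow> ('c,'z,'w) omega measure" where
  "omega_space D Z Ws K n =
     PiM (IM K) (\<lambda>_. D) \<Otimes>\<^sub>M PiM (IZ K n) (\<lambda>_. Z) \<Otimes>\<^sub>M PiM {..<K} (\<lambda>_. coin)
       \<Otimes>\<^sub>M PiM (IU K n) (\<lambda>_. coin) \<Otimes>\<^sub>M Ws"

text \<open>Joint law of the superclient/supersample construction together with W ~ P_{W|S}.
  Clients c carry data distributions mu c; the algorithm A is a Markov kernel from samples to
  hypotheses.\<close>
definition fl_joint ::
  "'c measure \<Rightarrow> ('c \<Rightarrow> 'z measure) \<Rightarrow> 'z measure \<Rightarrow> 'w measure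
     \<Rightarrow> ((nat \<times> nat \<Rightarrow> 'z) \<Rightarrow> 'w measure) \<Rightarrow> nat \<Rightarrow> nat \<Rightarrow> ('c,'z,'w) omega measure" where
  "fl_joint D \<mu> Z Ws A K n =
     bind (PiM (IM K) (\<lambda>_. D)) (\<lambda>m.
     bind (PiM (IZ K n) (\<lambda>(i,b,j,c). \<mu> (m (i,b)))) (\<lambda>zt.
     bind (PiM {..<K} (\<lambda>_. coin)) (\<lambda>v.
     bind (PiM (IU K n) (\<lambda>_. coin)) (\<lambda>u.
     bind (A (sample K n zt v u)) (\<lambda>w.
     return (omega_space D Z Ws K n) (m, zt, v, u, w))))))"

definition ZtOf :: "('c,'z,'w) omega \<Rightarrow> (nat \<times> bool \<times> nat \<times> bool \<Rightarrow> 'z)" where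
  "ZtOf \<omega> = fst (snd \<omega>)"
definition VOf :: "('c,'z,'w) omega \<Rightarrow> (nat \<Rightarrow> bool)" where
  "VOf \<omega> = fst (snd (snd \<omega>))"
definition UOf :: "('c,'z,'w) omega \<Rightarrow> (nat \<times> bool \<times> nat \<Rightarrow> bool)" where
  "UOf \<omega> = fst (snd (snd (snd \<omega>)))"
definition WOf :: "('c,'z,'w) omega \<Rightarrow> 'w" where
  "WOf \<omega> = snd (snd (snd (snd \<omega>)))"

definition pop_risk :: "'c measure \<Rightarrow> ('c \<Rightarrow> 'z measure) \<Rightarrow> ('w \<Rightarrow> 'z \<Rightarrow> real) \<Rightarrow> 'w \<Rightarrow> real" where
  "pop_risk D \<mu> loss w = (\<integral>c. (\<integral>z. loss w z \<partial>\<mu> c) \<partial>D)"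

definition emp_risk :: "nat \<Rightarrow> nat \<Rightarrow> ('w \<Rightarrow> 'z \<Rightarrow> real) \<Rightarrow> (nat \<times> nat \<Rightarrow> 'z) \<Rightarrow> 'w \<Rightarrow> real" where
  "emp_risk K n loss s w = (1 / (real K * real n)) * (\<Sum>i<K. \<Sum>j<n. loss w (s (i,j)))"

definition gen_error ::
  "'c measure \<Rightarrow> ('c \<Rightarrow> 'z measure) \<Rightarrow> 'z measure \<Rightarrow> 'w measure
     \<Rightarrow> ((nat \<times> nat \<Rightarrow> 'z) \<Rightarrow> 'w measure) \<Rightarrow> ('w \<Rightarrow> 'z \<Rightarrow> real) \<Rightarrow> nat \<Rightarrow> nat \<Rightarrow> real" where
  "gen_error D \<mu> Z Ws A loss K n =
     (let M = fl_joint D \<mu> Z Ws A K n in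
       (\<integral>\<omega>. pop_risk D \<mu> loss (WOf \<omega>) \<partial>M)
       - (\<integral>\<omega>. emp_risk K n loss (sample K n (ZtOf \<omega>) (VOf \<omega>) (UOf \<omega>)) (WOf \<omega>) \<partial>M))"

definition MI_real_bool :: "'a measure \<Rightarrow> ('a \<Rightarrow> real) \<Rightarrow> ('a \<Rightarrow> bool) \<Rightarrow> real" where
  "MI_real_bool M X Y = prob_space.mutual_information M (exp 1) borel (count_space UNIV) X Y"

text \<open>Disintegrated mutual information I^{Z=z}(X;Y) for a discrete conditioning variable Z:
  the mutual information under the conditional law P(. | Z = z).\<close>
definition disint_MI_real_bool ::
  "'a measure \<Rightarrow> ('a \<Rightarrow> real) \<Rightarrow> ('a \<Rightarrow> bool) \<Rightarrow> ('a \<Rightarrow> 'b) \<Rightarrow> 'b \<Rightarrow> real" where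
  "disint_MI_real_bool M X Y Zv z =
     MI_real_bool (uniform_measure M {\<omega> \<in> space M. Zv \<omega> = z}) X Y"

definition DeltaLbar :: "('w \<Rightarrow> 'z \<Rightarrow> real) \<Rightarrow> nat \<Rightarrow> ('c,'z,'w) omega \<Rightarrow> real" where
  "DeltaLbar loss i \<omega> =
     loss (WOf \<omega>) (ZtOf \<omega> (i, True, 0, \<not> UOf \<omega> (i, True, 0)))
     - loss (WOf \<omega>) (ZtOf \<omega> (i, False, 0, \<not> UOf \<omega> (i, False, 0)))"

definition DeltaL :: "('w \<Rightarrow> 'z \<Rightarrow> real) \<Rightarrow> nat \<Rightarrow> nat \<Rightarrow> ('c,'z,'w) omega \<Rightarrow> real" where
  "DeltaL loss i j \<omega> =
     loss (WOf \<omega>) (ZtOf \<omega> (i, VOf \<omega> i, j, True))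
     - loss (WOf \<omega>) (ZtOf \<omega> (i, VOf \<omega> i, j, False))"

end

theory Submission
  imports Defs
begin

text \<open>The generalization error is split at the expected loss on an unseen sample of a
  participating client. Each of the two gaps is the mean of a loss difference in [-1, 1], signed by a
  fair coin (V for the participation gap; U, given V, for the out-of-sample gap). Under the product
  of the marginals such a signed mean vanishes and the signed variable is 1-sub-Gaussian by
  Hoeffding's lemma, so the Donsker--Varadhan inequality bounds the mean under the joint law by
  sqrt (2 I). That unseen entries behave like fresh draws follows by resampling the corresponding
  coordinate of the product measure, on which the training sample does not depend.\<close>

subsection \<open>Mutual information with a fair coin\<close>

text \<open>Two obstacles shape the development. The library divergence is a Bochner integral, so
  bounding a mean by it requires the density to have integrable entropy. The coin supplies this: a
  joint law with a fair coin is at most twice the product of its marginals. Second,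
  \<open>fl_joint\<close> draws the coins after the supersample, whereas which entries are unseen is
  determined only once the coins are fixed. Expectations are therefore rewritten with the coins
  outermost. This reordering and the resampling use nonnegative integrals, which avoids
  integrability side conditions; Bochner integrals return only for the final expectations.

  The constant in sqrt (2 I) comes from the width 2 of [-1, 1]: Hoeffding's exponent is
  \<open>l\<^sup>2 * 2\<^sup>2 / 8\<close>, and the maximum of \<open>l * a - l\<^sup>2 / 2\<close>
  over \<open>l\<close> is \<open>a\<^sup>2 / 2\<close>. The participation term can use sample 0
  alone because the expected loss on an unseen sample of a participating client is the same for
  every \<open>j\<close>.\<close>

lemma (in prob_space) expectation_exp_le_of_bounded_centered:
  fixes g :: "'a \<Rightarrow> real"
  assumes g[measurable]: "random_variable borel g" and bound: "\<And>x. x \<in> space M \<Longrightarrow> \<bar>g x\<bar> \<le> 1"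
    and centered: "expectation g = 0"
  shows "expectation (\<lambda>x. exp (l * g x)) \<le> exp (l\<^sup>2 / 2)"
proof -
  have *: "expectation (\<lambda>x. exp (l * h x)) \<le> exp (l\<^sup>2 / 2)"
    if [measurable]: "random_variable borel h" and "\<And>x. x \<in> space M \<Longrightarrow> \<bar>h x\<bar> \<le> 1"
      and "expectation h = 0" and "0 < l" for h and l :: real
  proof -
    interpret interval_bounded_random_variable M h "-1" 1
      using that by unfold_locales (auto intro!: AE_I2 simp: abs_le_iff)
    have "(\<integral>\<^sup>+x. exp (l * h x) \<partial>M) \<le> ennreal (exp (l\<^sup>2 * (1 - (-1))\<^sup>2 / 8))"
      by (rule Hoeffdings_lemma_nn_integral_0) (use that in auto)
    moreover have "expectation (\<lambda>x. exp (l * h x)) = enn2real (\<integral>\<^sup>+x. exp (l * h x) \<partial>M)"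
      by (rule integral_eq_nn_integral) auto
    ultimately show ?thesis
      by (simp add: enn2real_leI)
  qed
  \<comment> \<open>The estimate above is for a positive parameter. A negative \<open>l\<close> is
    moved onto \<open>- g\<close>, which is again centred and bounded by 1.\<close>
  consider "l = 0" | "0 < l" | "0 < - l" by linarith
  then show ?thesis
  proof cases
    case 3
    then show ?thesis using *[of "\<lambda>x. - g x" "- l"] bound centered by simp
  qed (use *[of g l] bound centered prob_space in auto)
qed

text \<open>The domination hypothesis keeps the density bounded, so that its entropy is integrable and
  the divergence is not the junk value 0 of a non-integrable function.\<close>
lemma (in prob_space) square_integral_le_KL_divergence:
  fixes g :: "'a \<Rightarrow> real" and C :: real
  assumes N: "prob_space N" "sets N = sets M"
    and dom: "\<And>B. B \<in> sets M \<Longrightarrow> measure N B \<le> C * measure M B"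
    and g[measurable]: "random_variable borel g" and bound: "\<And>x. x \<in> space M \<Longrightarrow> \<bar>g x\<bar> \<le> 1"
    and centered: "expectation g = 0"
  shows "(\<integral>x. g x \<partial>N)\<^sup>2 \<le> 2 * KL_divergence (exp 1) M N"
proof -
  interpret N: prob_space N by fact
  note [measurable_cong] = N(2)
  have "absolutely_continuous M N"
  proof (unfold absolutely_continuous_def, rule subsetI)
    fix B assume "B \<in> null_sets M"
    then have "B \<in> sets M" "measure M B = 0" by (auto simp: measure_def)
    with dom[of B] have "measure N B = 0" by (simp add: antisym)
    with \<open>B \<in> sets M\<close> show "B \<in> null_sets N"
      by (simp add: null_sets_def N N.emeasure_eq_measure)
  qed
  then obtain f where f[measurable]: "f \<in> borel_measurable M"
    and RN: "AE x in M. RN_deriv M N x = ennreal (f x)" and f_nn: "\<And>x. 0 \<le> f x"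
    using real_RN_deriv[of N] N N.finite_measure_axioms by metis
  have dens: "N = density M f"
  proof -
    have "N = density M (RN_deriv M N)"
      using density_RN_deriv[OF \<open>absolutely_continuous M N\<close>] N by simp
    also have "\<dots> = density M f"
      by (rule density_cong) (use RN in auto)
    finally show ?thesis .
  qed
  have int_f[simp]: "integrable M f"
    by (rule integrableI_nonneg)
      (use N.emeasure_space_1 sets_eq_imp_space_eq[OF N(2)] f_nn
        in \<open>auto simp: dens emeasure_density less_top[symmetric] cong: nn_integral_cong\<close>)
  have integral_N: "(\<integral>x. h x \<partial>N) = (\<integral>x. f x * h x \<partial>M)"
    if "h \<in> borel_measurable M" for h :: "'a \<Rightarrow> real"
    unfolding dens by (subst integral_real_density) (use f_nn that in auto)
  have f1: "expectation f = 1"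
    using integral_N[of "\<lambda>_. 1"] N.prob_space by simp
  \<comment> \<open>On the set \<open>B\<close> where \<open>f\<close> exceeds \<open>C\<close>, the
    integral of \<open>f - C\<close> is \<open>measure N B - C * measure M B\<close>, hence at most
    0 by domination. Its integrand is nonnegative, so it vanishes almost everywhere, which leaves
    \<open>B\<close> null.\<close>
  have f_le: "AE x in M. f x \<le> C"
  proof -
    define B where "B = {x \<in> space M. C < f x}"
    have [measurable]: "B \<in> sets M" unfolding B_def by measurable
    have "measure N B = (\<integral>x. indicator B x \<partial>N)"
      by (simp add: N(2) sets_eq_imp_space_eq[OF N(2)])
    also have "\<dots> = (\<integral>x. f x * indicator B x \<partial>M)" by (rule integral_N) auto
    finally have NB: "measure N B = (\<integral>x. f x * indicator B x \<partial>M)" .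
    have iB: "integrable M (\<lambda>x. f x * indicator B x)"
      by (rule integrable_mult_indicator[of B M f, simplified mult.commute real_scaleR_def]) auto
    have iC: "integrable M (\<lambda>x. C * indicator B x)"
      by (intro integrable_mult_right integrable_real_indicator) (auto simp: less_top[symmetric])
    have "(\<integral>x. (f x - C) * indicator B x \<partial>M) = measure N B - C * measure M B"
      using iB iC by (simp add: left_diff_distrib NB Bochner_Integration.integral_diff)
    with dom[of B] have "(\<integral>x. (f x - C) * indicator B x \<partial>M) \<le> 0" by simp
    moreover have nn: "AE x in M. 0 \<le> (f x - C) * indicator B x"
      by (auto simp: B_def split: split_indicator)
    ultimately have "(\<integral>x. (f x - C) * indicator B x \<partial>M) = 0"
      using integral_nonneg_AE[OF nn] by simp
    then have "AE x in M. (f x - C) * indicator B x = 0"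
      using nn iB iC by (subst (asm) integral_nonneg_eq_0_iff_AE) (auto simp: left_diff_distrib)
    then show ?thesis
      using AE_space by eventually_elim (auto simp: B_def split: split_indicator_asm)
  qed
  \<comment> \<open>Donsker--Varadhan with test function \<open>l * g\<close> gives the lower bound
    \<open>l * a - l\<^sup>2 / 2\<close>, which is largest at \<open>l = a\<close>. The tilt
    \<open>y\<close> is built with this optimal parameter. Dividing by
    \<open>exp (a\<^sup>2 / 2)\<close> instead of the exact normalising constant suffices, since
    only \<open>expectation y \<le> 1\<close> is needed.\<close>
  define a where "a = (\<integral>x. g x \<partial>N)"
  define y where "y x = exp (a * g x - a\<^sup>2 / 2)" for x
  have [measurable]: "y \<in> borel_measurable M" unfolding y_def by measurable
  have int_fg: "integrable M (\<lambda>x. f x * g x)"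
    by (rule Bochner_Integration.integrable_bound[OF int_f])
      (use bound f_nn in \<open>auto simp: abs_mult intro!: AE_I2 mult_left_le\<close>)
  have exp_int: "integrable M (\<lambda>x. exp (a * g x))"
  proof (rule integrable_const_bound[of _ "exp \<bar>a\<bar>"])
    have "\<bar>a * g x\<bar> \<le> \<bar>a\<bar>" if "x \<in> space M" for x
      using bound[OF that] by (simp add: abs_mult mult_left_le)
    then show "AE x in M. norm (exp (a * g x)) \<le> exp \<bar>a\<bar>"
      by (auto intro!: AE_I2) (meson abs_le_D1)
  qed auto
  have y_eq: "y = (\<lambda>x. exp (a * g x) / exp (a\<^sup>2 / 2))"
    by (simp add: y_def exp_diff fun_eq_iff)
  have int_y: "integrable M y"
    using exp_int by (simp add: y_eq)
  have y_le: "expectation y \<le> 1"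
    using expectation_exp_le_of_bounded_centered[OF g bound centered, of a]
    by (simp add: y_eq)
  \<comment> \<open>From above, \<open>ln t \<le> t\<close> gives
    \<open>f ln f \<le> f * f \<le> C\<^sup>2\<close>; from below, the same inequality at
    \<open>1 / f\<close> gives \<open>f ln f \<ge> - 1\<close>. Where \<open>f\<close> vanishes the
    product is 0.\<close>
  have int_ent: "integrable M (\<lambda>x. f x * ln (f x))"
  proof (rule integrable_const_bound[of _ "1 + C\<^sup>2"])
    have "\<bar>f x * ln (f x)\<bar> \<le> 1 + C\<^sup>2" if "f x \<le> C" for x
    proof (cases "f x = 0")
      case False
      with f_nn[of x] have pos: "0 < f x" by simp
      have "f x * ln (f x) \<le> f x * f x"
        using pos by (intro mult_left_mono ln_bound) auto
      also have "\<dots> \<le> C\<^sup>2"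
        using that pos by (simp add: power2_eq_square mult_mono)
      finally have "f x * ln (f x) \<le> C\<^sup>2" .
      moreover have "ln (inverse (f x)) \<le> inverse (f x)"
        using pos by (intro ln_bound) auto
      then have "f x * (- ln (f x)) \<le> f x * inverse (f x)"
        using pos by (intro mult_left_mono) (auto simp: ln_inverse)
      then have "- (f x * ln (f x)) \<le> 1" using pos by simp
      moreover have "0 \<le> C\<^sup>2" by simp
      ultimately show ?thesis unfolding abs_le_iff by linarith
    qed simp
    with f_le show "AE x in M. norm (f x * ln (f x)) \<le> 1 + C\<^sup>2" by auto
  qed auto
  \<comment> \<open>Gibbs' inequality f ln f \<ge> f ln y + f - y against the exponential tilt y\<close>
  have "f x * (a * g x - a\<^sup>2 / 2) + f x - y x \<le> f x * ln (f x)" for x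
  proof (cases "f x = 0")
    case False
    with f_nn[of x] have pos: "0 < f x" by simp
    have "ln (y x / f x) \<le> y x / f x - 1"
      using pos by (intro ln_le_minus_one) (auto simp: y_def)
    then have "a * g x - a\<^sup>2 / 2 - ln (f x) \<le> y x / f x - 1"
      using pos by (simp add: ln_div y_def)
    then have "f x * (a * g x - a\<^sup>2 / 2 - ln (f x)) \<le> f x * (y x / f x - 1)"
      using pos by (intro mult_left_mono) auto
    then show ?thesis using pos by (simp add: algebra_simps)
  qed (simp add: y_def)
  then have "(\<integral>x. a * (f x * g x) - a\<^sup>2 / 2 * f x + f x - y x \<partial>M) \<le> (\<integral>x. f x * ln (f x) \<partial>M)"
    using int_ent int_fg int_y by (intro integral_mono) (auto simp: algebra_simps)
  \<comment> \<open>The mass of \<open>f\<close> contributes the 1, which outweighs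
    \<open>expectation y\<close>; what remains is \<open>a * a - a\<^sup>2 / 2\<close>, that is,
    half the squared mean.\<close>
  moreover have "(\<integral>x. a * (f x * g x) - a\<^sup>2 / 2 * f x + f x - y x \<partial>M)
      = a * a - a\<^sup>2 / 2 + 1 - expectation y"
    using int_fg int_y f1 integral_N[OF g] by (simp add: a_def[symmetric])
  moreover have "KL_divergence (exp 1) M N = (\<integral>x. f x * ln (f x) \<partial>M)"
    unfolding dens by (subst KL_density) (use f_nn in \<open>auto simp: log_def\<close>)
  ultimately show ?thesis
    using y_le by (simp add: a_def[symmetric] power2_eq_square)
qed

section \<open>The fair coin, and means signed by it\<close>

lemma sets_coin[measurable_cong]: "sets coin = sets (count_space UNIV)"
  by (simp add: coin_def)

lemma prob_space_coin: "prob_space coin"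
  unfolding coin_def by (rule prob_space_measure_pmf)

lemma emeasure_coin: "emeasure coin {b} = ennreal (1 / 2)"
proof -
  have "measure coin {b} = 1 / 2"
    by (cases b) (simp_all add: coin_def measure_pmf_single)
  moreover have "emeasure coin {b} = ennreal (measure coin {b})"
    unfolding coin_def by (rule measure_pmf.emeasure_eq_measure)
  ultimately show ?thesis by (simp only:)
qed

text \<open>On two points the complement rule fixes the other atom. This identifies the marginal of
  a selector, which enters mutual information as a \<open>distr\<close>, with
  \<open>coin\<close>.\<close>

lemma coin_eqI:
  assumes "prob_space N" "sets N = UNIV" "measure N {True} = 1 / 2"
  shows "N = coin"
proof -
  interpret prob_space N by fact
  have [simp]: "space N = UNIV" using sets_eq_imp_space_eq[of N "count_space UNIV"] assms by simp
  have "prob {False} = 1 - prob {True}"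
    using prob_compl[of "{True}"] assms by (simp add: UNIV_bool insert_Diff_if)
  with assms have "prob {b} = 1 / 2" for b by (cases b) auto
  then have "emeasure N {b} = emeasure coin {b}" for b
    by (simp only: emeasure_eq_measure emeasure_coin)
  then show ?thesis
    by (intro measure_eqI_finite[of _ UNIV]) (auto simp: assms(2) coin_def)
qed

text \<open>Mutual information is by definition the divergence of the joint law from the product of
  the marginals, so the divergence bound applies with that product as base measure. \<open>X\<close>
  and \<open>Y\<close> may depend on each other; fairness of \<open>Y\<close> is what centres the
  test function under the product.\<close>

lemma (in prob_space) abs_signed_expectation_le_mutual_information:
  assumes X[measurable]: "random_variable borel X" and bound: "\<And>x. x \<in> space M \<Longrightarrow> \<bar>X x\<bar> \<le> 1"
    and Y[measurable]: "random_variable (count_space UNIV) Y"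
    and unif: "prob {x \<in> space M. Y x} = 1 / 2"
  shows "\<bar>expectation (\<lambda>x. if Y x then - X x else X x)\<bar> \<le> sqrt (2 * MI_real_bool M X Y)"
proof -
  let ?X = "distr M borel X"
  let ?N = "distr M (borel \<Otimes>\<^sub>M count_space UNIV) (\<lambda>x. (X x, Y x))"
  interpret PX: prob_space ?X by (rule prob_space_distr) fact
  have Y_coin: "distr M (count_space UNIV) Y = coin"
  proof (rule coin_eqI)
    have "Y -` {True} \<inter> space M = {x \<in> space M. Y x}" by auto
    then show "measure (distr M (count_space UNIV) Y) {True} = 1 / 2"
      by (simp add: measure_distr unif)
  qed (auto intro!: prob_space_distr)
  interpret coin: prob_space coin by (rule prob_space_coin)
  interpret Q: pair_prob_space ?X coin ..
  have sets_Q: "sets (?X \<Otimes>\<^sub>M coin) = sets (borel \<Otimes>\<^sub>M count_space UNIV)"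
    by (intro sets_pair_measure_cong) (auto simp: sets_coin)
  \<comment> \<open>The bound on \<open>X\<close> holds on \<open>space M\<close>, but the test
    function lives on all of the real line times the booleans and must be bounded by 1 there.
    Clipping to [-1, 1] achieves this and changes nothing at the values that \<open>X\<close>
    takes.\<close>
  define g where "g = (\<lambda>(x::real, y). (if y then - 1 else 1) * max (- 1) (min 1 x))"
  have g[measurable]: "g \<in> borel_measurable (borel \<Otimes>\<^sub>M count_space UNIV)"
    unfolding g_def by measurable
  have g'[measurable]: "g \<in> borel_measurable (?X \<Otimes>\<^sub>M coin)"
    using g by (simp cong: measurable_cong_sets add: sets_Q)
  have g_bound: "\<bar>g z\<bar> \<le> 1" for z by (auto simp: g_def split: prod.split)
  have "(\<integral>z. g z \<partial>(?X \<Otimes>\<^sub>M coin)) = (\<integral>x. (\<integral>y. g (x, y) \<partial>coin) \<partial>?X)"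
    by (intro Q.integral_fst'[symmetric] Q.integrable_const_bound[of _ 1]) (auto simp: g_bound)
  also have "\<dots> = 0" unfolding coin_def by (simp add: g_def)
  finally have centered: "(\<integral>z. g z \<partial>(?X \<Otimes>\<^sub>M coin)) = 0" .
  \<comment> \<open>The factor 2 is the inverse mass of a coin face: the joint law gives
    \<open>B\<close> at most the sum of the masses of its two sections under the law of
    \<open>X\<close>, and the product gives it half that sum.\<close>
  have dom: "measure ?N B \<le> 2 * measure (?X \<Otimes>\<^sub>M coin) B" if "B \<in> sets (?X \<Otimes>\<^sub>M coin)" for B
  proof -
    have [measurable]: "B \<in> sets (borel \<Otimes>\<^sub>M count_space UNIV)" using that sets_Q by simp
    have [measurable]: "(\<lambda>x. (x, y)) -` B \<in> sets borel" for y
      using measurable_sets[of "\<lambda>x. (x, y)" borel "borel \<Otimes>\<^sub>M count_space UNIV" B] by simp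
    have half: "ennreal a * inverse 2 = ennreal (a / 2)" for a
      using ennreal_mult''[of "1 / 2" a] inverse_ennreal[of 2] by simp
    have "emeasure (?X \<Otimes>\<^sub>M coin) B = (\<integral>\<^sup>+y. emeasure ?X ((\<lambda>x. (x, y)) -` B) \<partial>coin)"
      by (rule Q.emeasure_pair_measure_alt2) fact
    also have "\<dots>
      = ennreal ((measure ?X ((\<lambda>x. (x, True)) -` B) + measure ?X ((\<lambda>x. (x, False)) -` B)) / 2)"
      unfolding coin_def by (simp add: PX.emeasure_eq_measure half add_divide_distrib)
    finally have Q: "2 * measure (?X \<Otimes>\<^sub>M coin) B
        = measure ?X ((\<lambda>x. (x, True)) -` B) + measure ?X ((\<lambda>x. (x, False)) -` B)"
      by (simp add: Q.emeasure_eq_measure)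
    have "measure ?N B = prob {x \<in> space M. (X x, Y x) \<in> B}"
      by (simp add: measure_distr vimage_def Int_def conj_commute)
    also have "\<dots> \<le> prob ({x \<in> space M. (X x, True) \<in> B} \<union> {x \<in> space M. (X x, False) \<in> B})"
      by (intro finite_measure_mono) (auto, metis (full_types))
    also have "\<dots> \<le> prob {x \<in> space M. (X x, True) \<in> B} + prob {x \<in> space M. (X x, False) \<in> B}"
      by (intro measure_Un_le) measurable
    also have "\<dots> = 2 * measure (?X \<Otimes>\<^sub>M coin) B"
      unfolding Q by (simp add: measure_distr vimage_def Int_def conj_commute)
    finally show ?thesis .
  qed
  have "(\<integral>z. g z \<partial>?N)\<^sup>2 \<le> 2 * KL_divergence (exp 1) (?X \<Otimes>\<^sub>M coin) ?N"
  proof (rule Q.square_integral_le_KL_divergence[where C = 2])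
    show "sets ?N = sets (?X \<Otimes>\<^sub>M coin)" by (simp only: sets_Q sets_distr)
  qed (auto intro!: prob_space_distr simp: dom g_bound centered)
  also have "KL_divergence (exp 1) (?X \<Otimes>\<^sub>M coin) ?N = MI_real_bool M X Y"
    by (simp add: MI_real_bool_def mutual_information_def Y_coin)
  also have "(\<integral>z. g z \<partial>?N) = expectation (\<lambda>x. g (X x, Y x))"
    by (simp add: integral_distr)
  also have "\<dots> = expectation (\<lambda>x. if Y x then - X x else X x)"
  proof (intro Bochner_Integration.integral_cong refl)
    fix x assume "x \<in> space M"
    from bound[OF this] show "g (X x, Y x) = (if Y x then - X x else X x)"
      by (auto simp: g_def max_def min_def abs_le_iff)
  qed
  finally have "sqrt ((expectation (\<lambda>x. if Y x then - X x else X x))\<^sup>2) \<le> sqrt (2 * MI_real_bool M X Y)"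
    by (rule real_sqrt_le_mono)
  then show ?thesis by simp
qed

section \<open>Conditioning on a binary variable\<close>

lemma (in prob_space) integral_uniform_measure:
  fixes f :: "'a \<Rightarrow> real"
  assumes [measurable]: "A \<in> events" "random_variable borel f" and pos: "0 < prob A"
  shows "(\<integral>x. f x \<partial>uniform_measure M A) = (\<integral>x. indicator A x * f x \<partial>M) / prob A"
proof -
  have "uniform_measure M A = density M (\<lambda>x. ennreal (indicator A x / prob A))"
    unfolding uniform_measure_def
    using pos by (intro arg_cong[where f = "density M"] ext)
      (auto simp: emeasure_eq_measure divide_ennreal[symmetric] split: split_indicator)
  then show ?thesis
    using pos by (simp add: integral_real_density)
qed

text \<open>As \<open>(V, Y)\<close> is uniform on four pairs, \<open>Y\<close> is still a fair coin
  under the conditional law given \<open>V = a\<close>, and the unconditional bound applies to that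
  law. Averaging over the two values of \<open>V\<close>, each of weight 1/2, is integration against
  the law of \<open>V\<close>.\<close>

lemma (in prob_space) abs_signed_expectation_le_disintegrated_mutual_information:
  fixes X :: "'a \<Rightarrow> real" and Y V :: "'a \<Rightarrow> bool"
  assumes X[measurable]: "random_variable borel X" and bound: "\<And>x. x \<in> space M \<Longrightarrow> \<bar>X x\<bar> \<le> 1"
    and Y[measurable]: "random_variable (count_space UNIV) Y"
    and V[measurable]: "random_variable (count_space UNIV) V"
    and unif: "\<And>a b. prob {x \<in> space M. V x = a \<and> Y x = b} = 1 / 4"
  shows "\<bar>expectation (\<lambda>x. if Y x then - X x else X x)\<bar>
    \<le> (\<integral>a. sqrt (2 * disint_MI_real_bool M X Y V a) \<partial>distr M (count_space UNIV) V)"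
proof -
  let ?g = "\<lambda>x. if Y x then - X x else X x"
  define E where "E a = {x \<in> space M. V x = a}" for a
  have [measurable]: "E a \<in> events" for a unfolding E_def by measurable
  have prob_E: "prob (E a) = 1 / 2" for a
  proof -
    have "E a = {x \<in> space M. V x = a \<and> Y x = True} \<union> {x \<in> space M. V x = a \<and> Y x = False}"
      by (auto simp: E_def)
    then have "prob (E a) = prob {x \<in> space M. V x = a \<and> Y x = True} + prob {x \<in> space M. V x
      = a \<and> Y x = False}"
      by (simp only:) (intro finite_measure_Union, auto)
    then show ?thesis by (simp only: unif)
  qed
  have cond: "\<bar>\<integral>x. ?g x \<partial>uniform_measure M (E a)\<bar> \<le> sqrt (2 * disint_MI_real_bool M X Y V a)" for a
  proof -
    interpret U: prob_space "uniform_measure M (E a)"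
      by (rule prob_space_uniform_measure) (auto simp: emeasure_eq_measure prob_E)
    have "measure (uniform_measure M (E a)) {x \<in> space M. Y x}
      = prob (E a \<inter> {x \<in> space M. Y x}) / prob (E a)"
      by (rule measure_uniform_measure) (auto simp: emeasure_eq_measure prob_E)
    also have "E a \<inter> {x \<in> space M. Y x} = {x \<in> space M. V x = a \<and> Y x = True}"
      by (auto simp: E_def)
    finally have "measure (uniform_measure M (E a)) {x \<in> space M. Y x} = 1 / 2"
      by (simp only: unif prob_E) simp
    then show ?thesis
      using U.abs_signed_expectation_le_mutual_information[of X Y] bound
      by (simp add: disint_MI_real_bool_def E_def)
  qed
  have int_g: "integrable M ?g"
    by (rule integrable_const_bound[of _ 1]) (use bound in auto)
  have int_E: "integrable M (\<lambda>x. indicator (E a) x * ?g x)" for a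
    using integrable_mult_indicator[OF _ int_g, of "E a"] by simp
  have "expectation ?g = (\<integral>x. indicator (E True) x * ?g x + indicator (E False) x * ?g x \<partial>M)"
    by (intro Bochner_Integration.integral_cong) (auto simp: E_def split: split_indicator)
  also have "\<dots> = (\<integral>x. indicator (E True) x * ?g x \<partial>M) + (\<integral>x. indicator (E False) x * ?g x \<partial>M)"
    by (rule Bochner_Integration.integral_add[OF int_E int_E])
  also have "\<dots> = 1 / 2 * (\<integral>x. ?g x \<partial>uniform_measure M (E True))
      + 1 / 2 * (\<integral>x. ?g x \<partial>uniform_measure M (E False))"
    by (subst (1 2) integral_uniform_measure) (simp_all add: prob_E)
  finally have "\<bar>expectation ?g\<bar> \<le> 1 / 2 * sqrt (2 * disint_MI_real_bool M X Y V True)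
      + 1 / 2 * sqrt (2 * disint_MI_real_bool M X Y V False)"
    using cond[of True] cond[of False] by linarith
  moreover have "distr M (count_space UNIV) V = coin"
  proof (rule coin_eqI)
    have "V -` {True} \<inter> space M = E True" by (auto simp: E_def)
    then show "measure (distr M (count_space UNIV) V) {True} = 1 / 2"
      by (simp add: measure_distr prob_E)
  qed (auto intro!: prob_space_distr)
  ultimately show ?thesis
    by (simp add: coin_def)
qed

subsection \<open>Finite products of kernels\<close>

lemma emeasure_PiM_finite:
  assumes I: "finite I" and M: "\<And>i. i \<in> I \<Longrightarrow> prob_space (M i)"
    and A: "\<And>i. i \<in> I \<Longrightarrow> A i \<in> sets (M i)"
  shows "emeasure (PiM I M) (Pi\<^sub>E I A) = (\<Prod>i\<in>I. emeasure (M i) (A i))"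
proof -
  have "prod_emb I M I (Pi\<^sub>E I A) = Pi\<^sub>E I A"
    using A sets.sets_into_space by (intro prod_emb_PiE_same_index) auto
  then show ?thesis
    using emeasure_PiM_emb[of I M I A] assms by simp
qed

text \<open>It is enough to test on boxes, an intersection-stable generator of the product
  sigma-algebra. There the product measure is a finite product of factors, each measurable in
  \<open>x\<close>. This is what makes the law of the supersample a kernel in the vector of
  clients.\<close>

lemma measurable_PiM_kernel:
  assumes I: "finite I" and k: "\<And>i. i \<in> I \<Longrightarrow> k i \<in> M \<rightarrow>\<^sub>M prob_algebra (N i)"
  shows "(\<lambda>x. PiM I (\<lambda>i. k i x)) \<in> M \<rightarrow>\<^sub>M prob_algebra (PiM I N)"
proof (rule measurable_prob_algebra_generated)
  show "sets (PiM I N) = sigma_sets (\<Pi>\<^sub>E i\<in>I. space (N i)) (prod_algebra I N)"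
    by (rule sets_PiM)
  show "Int_stable (prod_algebra I N)" by (rule Int_stable_prod_algebra)
  show "prod_algebra I N \<subseteq> Pow (\<Pi>\<^sub>E i\<in>I. space (N i))" by (rule prod_algebra_sets_into_space)
next
  fix x assume x: "x \<in> space M"
  have kx: "prob_space (k i x)" "sets (k i x) = sets (N i)" if "i \<in> I" for i
    using measurable_space[OF k[OF that] x] by (auto simp: space_prob_algebra)
  show "prob_space (PiM I (\<lambda>i. k i x))" by (intro prob_space_PiM kx)
  show "sets (PiM I (\<lambda>i. k i x)) = sets (PiM I N)" by (intro sets_PiM_cong kx) auto
next
  fix A assume "A \<in> prod_algebra I N"
  then obtain F where A: "A = Pi\<^sub>E I F" and F: "\<And>i. i \<in> I \<Longrightarrow> F i \<in> sets (N i)"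
    using I by (auto simp: prod_algebra_eq_finite)
  have "(\<lambda>x. emeasure (PiM I (\<lambda>i. k i x)) A) \<in> borel_measurable M
      \<longleftrightarrow> (\<lambda>x. \<Prod>i\<in>I. emeasure (k i x) (F i)) \<in> borel_measurable M"
  proof (rule measurable_cong)
    fix x assume x: "x \<in> space M"
    have "prob_space (k i x)" "sets (k i x) = sets (N i)" if "i \<in> I" for i
      using measurable_space[OF k[OF that] x] by (auto simp: space_prob_algebra)
    then show "emeasure (PiM I (\<lambda>i. k i x)) A = (\<Prod>i\<in>I. emeasure (k i x) (F i))"
      unfolding A using F I by (intro emeasure_PiM_finite) auto
  qed
  also have "\<dots>"
  proof (intro borel_measurable_prod_ennreal)
    fix i assume i: "i \<in> I"
    show "(\<lambda>x. emeasure (k i x) (F i)) \<in> borel_measurable M"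
      using measurable_compose[OF measurable_prob_algebraD[OF k[OF i]]
          measurable_emeasure_subprob_algebra[OF F[OF i]]] .
  qed
  finally show "(\<lambda>x. emeasure (PiM I (\<lambda>i. k i x)) A) \<in> borel_measurable M" .
qed

text \<open>Overwriting one coordinate of a product-distributed point by an independent draw from
  its factor preserves the product law, since the two laws agree on boxes. Parts of \<open>f\<close>
  that ignore coordinate \<open>t\<close> then no longer interact with \<open>z\<close>.\<close>

lemma nn_integral_PiM_resample:
  assumes I: "finite I" and t: "t \<in> I" and M: "\<And>i. i \<in> I \<Longrightarrow> prob_space (M i)"
    and f[measurable]: "f \<in> borel_measurable (PiM I M)"
  shows "(\<integral>\<^sup>+x. f x \<partial>PiM I M) = (\<integral>\<^sup>+x. (\<integral>\<^sup>+z. f (x(t := z)) \<partial>M t) \<partial>PiM I M)"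
proof -
  interpret P: prob_space "PiM I M" by (rule prob_space_PiM) fact
  interpret T: prob_space "M t" using M t by auto
  interpret PT: pair_prob_space "PiM I M" "M t" ..
  have upd[measurable]: "(\<lambda>(x, z). x(t := z)) \<in> PiM I M \<Otimes>\<^sub>M M t \<rightarrow>\<^sub>M PiM I M"
  proof -
    have "insert t I = I" using t by auto
    then show ?thesis using measurable_add_dim[of t I M] by simp
  qed
  have "distr (PiM I M \<Otimes>\<^sub>M M t) (PiM I M) (\<lambda>(x, z). x(t := z)) = PiM I M" (is "?D = _")
  proof (rule measure_eqI_PiM_finite[OF I])
    fix A assume A: "\<And>i. i \<in> I \<Longrightarrow> A i \<in> sets (M i)"
    \<comment> \<open>The update discards the old coordinate \<open>t\<close>. In the preimage of a
      box the old point is thus unconstrained at \<open>t\<close>, and the constraint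
      \<open>A t\<close> falls on the fresh coordinate.\<close>
    let ?A = "A(t := space (M t))"
    have A': "?A i \<in> sets (M i)" if "i \<in> I" for i using A that by auto
    have "(\<lambda>(x, z). x(t := z)) -` Pi\<^sub>E I A \<inter> space (PiM I M \<Otimes>\<^sub>M M t) = Pi\<^sub>E I ?A \<times> A t"
    proof -
      have sub: "A i \<subseteq> space (M i)" if "i \<in> I" for i using A that sets.sets_into_space by blast
      show ?thesis
        using t sub
        by (auto simp: space_pair_measure space_PiM PiE_iff extensional_def fun_upd_apply subset_eq
            split: if_splits) metis
    qed
    moreover have "Pi\<^sub>E I A \<in> sets (PiM I M)" "Pi\<^sub>E I ?A \<in> sets (PiM I M)"
      using A A' I by (auto intro!: sets_PiM_I_finite)
    ultimately have "emeasure ?D (Pi\<^sub>E I A) = emeasure (PiM I M) (Pi\<^sub>E I ?A) * emeasure (M t) (A t)"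
      using A t by (simp add: emeasure_distr T.emeasure_pair_measure_Times)
    also have "\<dots> = (\<Prod>i\<in>I. emeasure (M i) (?A i)) * emeasure (M t) (A t)"
      by (subst emeasure_PiM_finite[OF I M A']) auto
    also have "\<dots> = (\<Prod>i\<in>I - {t}. emeasure (M i) (A i)) * emeasure (M t) (A t)"
      using t I by (simp add: prod.remove[of I t] T.emeasure_space_1)
    also have "\<dots> = emeasure (PiM I M) (Pi\<^sub>E I A)"
      using t I by (simp add: emeasure_PiM_finite[OF I M A] prod.remove[of I t] mult.commute)
    finally show "emeasure ?D (Pi\<^sub>E I A) = emeasure (PiM I M) (Pi\<^sub>E I A)" .
  next
    show "range (\<lambda>_::nat. space (PiM I M)) \<subseteq> prod_algebra I M"
      using I by (auto simp: space_PiM intro!: prod_algebraI_finite)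
    show "(\<Union>_::nat. space (PiM I M)) = space (PiM I M)" by simp
    show "emeasure ?D (space (PiM I M)) \<noteq> \<infinity>" for i :: nat
      by (simp add: emeasure_distr measurable_space[OF upd] PT.P.emeasure_finite)
  qed auto
  then have "(\<integral>\<^sup>+x. f x \<partial>PiM I M) = (\<integral>\<^sup>+x. f x \<partial>?D)" by simp
  also have "\<dots> = (\<integral>\<^sup>+p. f ((\<lambda>(x, z). x(t := z)) p) \<partial>(PiM I M \<Otimes>\<^sub>M M t))"
    by (rule nn_integral_distr) auto
  also have "\<dots> = (\<integral>\<^sup>+x. (\<integral>\<^sup>+z. f (x(t := z)) \<partial>M t) \<partial>PiM I M)"
    by (subst T.nn_integral_fst[symmetric]) (auto simp: measurable_compose[OF upd f])
  finally show ?thesis .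
qed

text \<open>Peels off one stage of the joint law when both the measure and the kernel depend on the
  earlier stages: at fixed \<open>x\<close>, the section of the jointly measurable \<open>k\<close>
  is a kernel on \<open>N\<close>.\<close>

lemma nn_integral_bind_kernel:
  assumes k: "k \<in> M \<Otimes>\<^sub>M N \<rightarrow>\<^sub>M prob_algebra B" and L: "L \<in> M \<rightarrow>\<^sub>M prob_algebra N"
    and x: "x \<in> space M" and h: "h \<in> borel_measurable B"
  shows "(\<integral>\<^sup>+y. h y \<partial>bind (L x) (\<lambda>y. k (x, y))) = (\<integral>\<^sup>+y. (\<integral>\<^sup>+z. h z \<partial>k (x, y)) \<partial>L x)"
proof (rule nn_integral_bind[OF h])
  have "sets (L x) = sets N"
    using measurable_space[OF L x] by (simp add: space_prob_algebra)
  moreover have "(\<lambda>y. k (x, y)) \<in> N \<rightarrow>\<^sub>M subprob_algebra B"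
    using measurable_compose[OF measurable_Pair1'[OF x] measurable_prob_algebraD[OF k]] .
  ultimately show "(\<lambda>y. k (x, y)) \<in> L x \<rightarrow>\<^sub>M subprob_algebra B"
    by (simp cong: measurable_cong_sets)
qed

lemma nn_integral_PiM_coin_indicator:
  assumes "finite I" "t \<in> I"
  shows "(\<integral>\<^sup>+x. indicator {b} (x t) \<partial>PiM I (\<lambda>_. coin)) = ennreal (1 / 2)"
proof -
  have t[measurable]: "(\<lambda>x. x t) \<in> PiM I (\<lambda>_. coin) \<rightarrow>\<^sub>M coin"
    by (rule measurable_component_singleton[OF assms(2)])
  have b: "{b} \<in> sets coin" by (simp add: sets_coin)
  have "(\<integral>\<^sup>+x. indicator {b} (x t) \<partial>PiM I (\<lambda>_. coin))
      = (\<integral>\<^sup>+y. indicator {b} y \<partial>distr (PiM I (\<lambda>_. coin)) coin (\<lambda>x. x t))"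
    using b by (intro nn_integral_distr[symmetric]) auto
  also have "distr (PiM I (\<lambda>_. coin)) coin (\<lambda>x. x t) = coin"
    using distr_PiM_component[of I "\<lambda>_. coin" t] assms prob_space_coin by auto
  finally show ?thesis using b by (simp add: emeasure_coin)
qed

subsection \<open>The supersample construction\<close>

text \<open>Training entries sit at indices that depend on the coins. As such an index is boolean,
  evaluation there is a case distinction between two fixed indices, each of which is a coordinate
  projection.\<close>

lemma measurable_if_index:
  assumes "\<And>b. b \<in> UNIV \<Longrightarrow> f b \<in> M \<rightarrow>\<^sub>M N" and g[measurable]: "g \<in> M \<rightarrow>\<^sub>M count_space (UNIV :: bool set)"
  shows "(\<lambda>x. f (g x) x) \<in> M \<rightarrow>\<^sub>M N"
proof -
  have [measurable]: "f True \<in> M \<rightarrow>\<^sub>M N" "f False \<in> M \<rightarrow>\<^sub>M N" using assms by auto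
  have "(\<lambda>x. if g x then f True x else f False x) \<in> M \<rightarrow>\<^sub>M N" by measurable
  moreover have "(\<lambda>x. if g x then f True x else f False x) = (\<lambda>x. f (g x) x)" by auto
  ultimately show ?thesis by simp
qed

lemma measurable_supersample_entry:
  assumes zt: "zt \<in> M \<rightarrow>\<^sub>M PiM (IZ K n) (\<lambda>_. Z)"
    and [measurable]: "f \<in> M \<rightarrow>\<^sub>M count_space UNIV" "g \<in> M \<rightarrow>\<^sub>M count_space UNIV"
    and ij: "i < K" "j < n"
  shows "(\<lambda>x. zt x (i, f x, j, g x)) \<in> M \<rightarrow>\<^sub>M Z"
proof (rule measurable_if_index[where g = f])
  fix b
  show "(\<lambda>x. zt x (i, b, j, g x)) \<in> M \<rightarrow>\<^sub>M Z"
  proof (rule measurable_if_index[where g = g])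
    fix c
    show "(\<lambda>x. zt x (i, b, j, c)) \<in> M \<rightarrow>\<^sub>M Z"
      using ij by (intro measurable_compose[OF zt] measurable_component_singleton) (auto simp: IZ_def)
  qed fact
qed fact

lemma measurable_participation:
  assumes v: "v \<in> M \<rightarrow>\<^sub>M PiM {..<K} (\<lambda>_. coin)" and i: "i < K"
  shows "(\<lambda>x. v x i) \<in> M \<rightarrow>\<^sub>M count_space UNIV"
proof -
  have "(\<lambda>x. v x i) \<in> M \<rightarrow>\<^sub>M coin"
    using i by (intro measurable_compose[OF v] measurable_component_singleton) auto
  then show ?thesis using measurable_cong_sets[OF refl sets_coin] by blast
qed

lemma measurable_selector:
  assumes u: "u \<in> M \<rightarrow>\<^sub>M PiM (IU K n) (\<lambda>_. coin)"
    and f: "f \<in> M \<rightarrow>\<^sub>M count_space UNIV" and ij: "i < K" "j < n"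
  shows "(\<lambda>x. u x (i, f x, j)) \<in> M \<rightarrow>\<^sub>M count_space UNIV"
proof (rule measurable_if_index[OF _ f])
  fix b
  have "(\<lambda>x. u x (i, b, j)) \<in> M \<rightarrow>\<^sub>M coin"
    using ij by (intro measurable_compose[OF u] measurable_component_singleton) (auto simp: IU_def)
  then show "(\<lambda>x. u x (i, b, j)) \<in> M \<rightarrow>\<^sub>M count_space UNIV"
    using measurable_cong_sets[OF refl sets_coin] by blast
qed

lemma measurable_sample:
  assumes "zt \<in> M \<rightarrow>\<^sub>M PiM (IZ K n) (\<lambda>_. Z)"
    and "v \<in> M \<rightarrow>\<^sub>M PiM {..<K} (\<lambda>_. coin)"
    and "u \<in> M \<rightarrow>\<^sub>M PiM (IU K n) (\<lambda>_. coin)"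
  shows "(\<lambda>x. sample K n (zt x) (v x) (u x)) \<in> M \<rightarrow>\<^sub>M sample_space Z K n"
  unfolding sample_def sample_space_def
proof (rule measurable_restrict)
  fix ij assume "ij \<in> {..<K} \<times> {..<n}"
  then obtain i j where ij: "ij = (i, j)" "i < K" "j < n" by auto
  note v = measurable_participation[OF assms(2) ij(2)]
  show "(\<lambda>x. case ij of (i, j) \<Rightarrow> zt x (i, v x i, j, u x (i, v x i, j))) \<in> M \<rightarrow>\<^sub>M Z"
    unfolding ij(1) prod.case
    by (rule measurable_supersample_entry[OF assms(1) v measurable_selector[OF assms(3) v ij(2,3)] ij(2,3)])
qed

lemma measurable_const_prob: "prob_space N \<Longrightarrow> (\<lambda>_. N) \<in> M \<rightarrow>\<^sub>M prob_algebra N"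
  by (auto simp: space_prob_algebra)

lemma bind_in_prob_algebra:
  assumes "prob_space M" and "k \<in> M \<rightarrow>\<^sub>M prob_algebra N"
  shows "bind M k \<in> space (prob_algebra N)"
proof -
  have M: "M \<in> space (prob_algebra M)" using assms(1) by (simp add: space_prob_algebra)
  show ?thesis
    using prob_space_bind'[OF M assms(2)] sets_bind'[OF M assms(2)] by (simp add: space_prob_algebra)
qed

section \<open>The joint law as an iterated integral\<close>

locale federated =
  fixes D :: "'c measure" and \<mu> :: "'c \<Rightarrow> 'z measure" and Z :: "'z measure"
    and Ws :: "'w measure" and A :: "(nat \<times> nat \<Rightarrow> 'z) \<Rightarrow> 'w measure" and K n :: nat
  assumes prob_D: "prob_space D"
    and \<mu>[measurable]: "\<mu> \<in> D \<rightarrow>\<^sub>M prob_algebra Z"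
    and A[measurable]: "A \<in> sample_space Z K n \<rightarrow>\<^sub>M prob_algebra Ws"
begin

abbreviation "PD \<equiv> PiM (IM K) (\<lambda>_. D)"
text \<open>Unlike \<open>PD\<close>, \<open>PV\<close> and \<open>PU\<close>, which are the laws of
  the clients and of the coins, this measure supplies the measurable space of supersamples. Their
  law depends on the clients and is the kernel \<open>supersample_law\<close>.\<close>

abbreviation "PZ \<equiv> PiM (IZ K n) (\<lambda>_. Z)"
abbreviation "PV \<equiv> PiM {..<K} (\<lambda>_. coin)"
abbreviation "PU \<equiv> PiM (IU K n) (\<lambda>_. coin)"
abbreviation "\<Omega> \<equiv> omega_space D Z Ws K n"

definition supersample_law :: "(nat \<times> bool \<Rightarrow> 'c) \<Rightarrow> (nat \<times> bool \<times> nat \<times> bool \<Rightarrow> 'z) measure" where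
  "supersample_law m = PiM (IZ K n) (\<lambda>(i, b, j, c). \<mu> (m (i, b)))"

lemma prob_PD: "prob_space PD" and prob_PV: "prob_space PV" and prob_PU: "prob_space PU"
  by (auto intro!: prob_space_PiM prob_D prob_space_coin)

lemma finite_IZ: "finite (IZ K n)" by (simp add: IZ_def)

lemma prob_\<mu>: "c \<in> space D \<Longrightarrow> prob_space (\<mu> c)" and sets_\<mu>: "c \<in> space D \<Longrightarrow> sets (\<mu> c) = sets Z"
  using measurable_space[OF \<mu>] by (auto simp: space_prob_algebra)

lemma prob_A: "s \<in> space (sample_space Z K n) \<Longrightarrow> prob_space (A s)"
  and sets_A: "s \<in> space (sample_space Z K n) \<Longrightarrow> sets (A s) = sets Ws"
  using measurable_space[OF A] by (auto simp: space_prob_algebra)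

lemma measurable_client: "(\<lambda>m. m s) \<in> PD \<rightarrow>\<^sub>M D" if "s \<in> IM K"
  using that by (rule measurable_component_singleton)

lemma measurable_supersample_law[measurable]: "supersample_law \<in> PD \<rightarrow>\<^sub>M prob_algebra PZ"
  unfolding supersample_law_def case_prod_unfold
proof (rule measurable_PiM_kernel[OF finite_IZ, where k = "\<lambda>x m. \<mu> (m (fst x, fst (snd x)))"])
qed (auto simp: IZ_def IM_def intro!: measurable_compose[OF measurable_client \<mu>])

text \<open>The law of the supersample varies with \<open>m\<close>. Bundling the two into one
  measure on a product makes Fubini's theorem applicable against the independent coins.\<close>

definition client_supersample_law :: "((nat \<times> bool \<Rightarrow> 'c) \<times> (nat \<times> bool \<times> nat \<times> bool \<Rightarrow> 'z)) measure" where
  "client_supersample_law = bind PD (\<lambda>m. bind (supersample_law m) (\<lambda>zt. return (PD \<Otimes>\<^sub>M PZ) (m, zt)))"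

lemma client_supersample_law: "client_supersample_law \<in> space (prob_algebra (PD \<Otimes>\<^sub>M PZ))"
  unfolding client_supersample_law_def
  by (rule bind_in_prob_algebra[OF prob_PD]) measurable

lemma nn_integral_client_supersample_law:
  assumes h[measurable]: "h \<in> borel_measurable (PD \<Otimes>\<^sub>M PZ)"
  shows "(\<integral>\<^sup>+p. h p \<partial>client_supersample_law) = (\<integral>\<^sup>+m. (\<integral>\<^sup>+zt. h (m, zt) \<partial>supersample_law m) \<partial>PD)"
proof -
  have "(\<integral>\<^sup>+p. h p \<partial>client_supersample_law)
      = (\<integral>\<^sup>+m. (\<integral>\<^sup>+p. h p \<partial>bind (supersample_law m) (\<lambda>zt. return (PD \<Otimes>\<^sub>M PZ) (m, zt))) \<partial>PD)"
    unfolding client_supersample_law_def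
    by (rule nn_integral_bind[where B = "PD \<Otimes>\<^sub>M PZ", OF h], rule measurable_prob_algebraD) measurable
  also have "\<dots> = (\<integral>\<^sup>+m. (\<integral>\<^sup>+zt. h (m, zt) \<partial>supersample_law m) \<partial>PD)"
  proof (rule nn_integral_cong)
    fix m assume m: "m \<in> space PD"
    have sp: "space (supersample_law m) = space PZ"
      using measurable_space[OF measurable_supersample_law m]
        by (auto simp: space_prob_algebra dest: sets_eq_imp_space_eq)
    have "(\<integral>\<^sup>+p. h p \<partial>bind (supersample_law m) (\<lambda>zt. return (PD \<Otimes>\<^sub>M PZ) (m, zt)))
        = (\<integral>\<^sup>+zt. (\<integral>\<^sup>+p. h p \<partial>return (PD \<Otimes>\<^sub>M PZ) (m, zt)) \<partial>supersample_law m)"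
      by (rule nn_integral_bind_kernel[OF _ measurable_supersample_law m h]) measurable
    also have "\<dots> = (\<integral>\<^sup>+zt. h (m, zt) \<partial>supersample_law m)"
      using m by (intro nn_integral_cong nn_integral_return) (auto simp: sp space_pair_measure)
    finally show "(\<integral>\<^sup>+p. h p \<partial>bind (supersample_law m) (\<lambda>zt. return (PD \<Otimes>\<^sub>M PZ) (m, zt)))
        = (\<integral>\<^sup>+zt. h (m, zt) \<partial>supersample_law m)" .
  qed
  finally show ?thesis .
qed

text \<open>These are the successive tails of \<open>fl_joint\<close> once the earlier variables are
  given. Each takes a single tuple as argument, so that joint measurability in all earlier variables
  is measurability of one kernel.\<close>

definition law_given_selectors where
  "law_given_selectors p = (case p of (((m, zt), v), u) \<Rightarrow>
     bind (A (sample K n zt v u)) (\<lambda>w. return \<Omega> (m, zt, v, u, w)))"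
definition law_given_participation where "law_given_participation p
  = bind PU (\<lambda>u. law_given_selectors (p, u))"
definition law_given_supersample where "law_given_supersample p
  = bind PV (\<lambda>v. law_given_participation (p, v))"

lemma measurable_law_given_selectors[measurable]: "law_given_selectors \<in> ((PD \<Otimes>\<^sub>M PZ) \<Otimes>\<^sub>M PV) \<Otimes>\<^sub>M PU
  \<rightarrow>\<^sub>M prob_algebra \<Omega>"
  unfolding law_given_selectors_def case_prod_unfold
proof (rule measurable_bind_prob_space2)
  let ?S = "((PD \<Otimes>\<^sub>M PZ) \<Otimes>\<^sub>M PV) \<Otimes>\<^sub>M PU"
  show "(\<lambda>p. A (sample K n (snd (fst (fst p))) (snd (fst p)) (snd p))) \<in> ?S \<rightarrow>\<^sub>M prob_algebra Ws"
    by (rule measurable_compose[OF measurable_sample A]) measurable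
  show "(\<lambda>(p, w). return \<Omega> (fst (fst (fst p)), snd (fst (fst p)), snd (fst p), snd p, w))
      \<in> ?S \<Otimes>\<^sub>M Ws \<rightarrow>\<^sub>M prob_algebra \<Omega>"
    unfolding omega_space_def by measurable
qed

lemma measurable_law_given_participation[measurable]: "law_given_participation \<in> (PD \<Otimes>\<^sub>M PZ) \<Otimes>\<^sub>M PV
  \<rightarrow>\<^sub>M prob_algebra \<Omega>"
  unfolding law_given_participation_def
    by (rule measurable_bind_prob_space2[OF measurable_const_prob[OF prob_PU]]) measurable

lemma measurable_law_given_supersample[measurable]: "law_given_supersample \<in> PD \<Otimes>\<^sub>M PZ
  \<rightarrow>\<^sub>M prob_algebra \<Omega>"
  unfolding law_given_supersample_def
    by (rule measurable_bind_prob_space2[OF measurable_const_prob[OF prob_PV]]) measurable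

lemma fl_joint_eq: "fl_joint D \<mu> Z Ws A K n = bind PD (\<lambda>m. bind (supersample_law m)
  (\<lambda>zt. law_given_supersample (m, zt)))"
  unfolding fl_joint_def law_given_supersample_def law_given_participation_def
    law_given_selectors_def supersample_law_def by simp

lemma fl_joint_prob_algebra: "fl_joint D \<mu> Z Ws A K n \<in> space (prob_algebra \<Omega>)"
  unfolding fl_joint_eq
  by (rule bind_in_prob_algebra[OF prob_PD]) measurable

text \<open>The laws of the coins do not depend on the clients or the supersample, so their
  integrals can be moved outermost. For fixed \<open>v\<close> and \<open>u\<close> the positions of
  the training entries are deterministic, as resampling a coordinate requires.\<close>

lemma nn_integral_fl_joint:
  assumes h: "h \<in> borel_measurable \<Omega>"
  shows "(\<integral>\<^sup>+\<omega>. h \<omega> \<partial>fl_joint D \<mu> Z Ws A K n) =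
    (\<integral>\<^sup>+v. \<integral>\<^sup>+u. \<integral>\<^sup>+m. \<integral>\<^sup>+zt. \<integral>\<^sup>+w. h (m, zt, v, u, w) \<partial>A (sample K n zt v u) \<partial>supersample_law m \<partial>PD
      \<partial>PU \<partial>PV)"
proof -
  interpret PV: prob_space PV by (rule prob_PV)
  interpret PU: prob_space PU by (rule prob_PU)
  interpret client_supersample_law: prob_space client_supersample_law using client_supersample_law
    by (simp add: space_prob_algebra)
  have sets_client_supersample_law[measurable_cong]: "sets client_supersample_law
    = sets (PD \<Otimes>\<^sub>M PZ)" using client_supersample_law by (simp add: space_prob_algebra)
  have space_client_supersample_law: "space client_supersample_law = space (PD \<Otimes>\<^sub>M PZ)"
    using sets_client_supersample_law by (rule sets_eq_imp_space_eq)
  interpret VDZ: pair_sigma_finite PV client_supersample_law ..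
  interpret UDZ: pair_sigma_finite PU client_supersample_law ..
  have space_supersample_law: "space (supersample_law m) = space PZ" if "m \<in> space PD" for m
    using measurable_space[OF measurable_supersample_law that]
      by (auto simp: space_prob_algebra dest: sets_eq_imp_space_eq)
  define F where "F p = (\<integral>\<^sup>+\<omega>. h \<omega> \<partial>law_given_selectors p)" for p
  have F[measurable]: "F \<in> borel_measurable (((PD \<Otimes>\<^sub>M PZ) \<Otimes>\<^sub>M PV) \<Otimes>\<^sub>M PU)"
    unfolding F_def
    by (rule measurable_compose[OF
      measurable_prob_algebraD[OF measurable_law_given_selectors] nn_integral_measurable_subprob_algebra[OF h]])
  have [measurable]: "(\<lambda>p. \<integral>\<^sup>+\<omega>. h \<omega> \<partial>law_given_supersample p) \<in> borel_measurable (PD \<Otimes>\<^sub>M PZ)"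
    by (rule measurable_compose[OF
      measurable_prob_algebraD[OF measurable_law_given_supersample] nn_integral_measurable_subprob_algebra[OF h]])
  have F_eq: "F (((m, zt), v), u) = (\<integral>\<^sup>+w. h (m, zt, v, u, w) \<partial>A (sample K n zt v u))"
    if sp: "m \<in> space PD" "zt \<in> space PZ" "v \<in> space PV" "u \<in> space PU" for m zt v u
  proof -
    let ?p = "(((m, zt), v), u)"
    have p: "?p \<in> space (((PD \<Otimes>\<^sub>M PZ) \<Otimes>\<^sub>M PV) \<Otimes>\<^sub>M PU)" using sp by (simp add: space_pair_measure)
    have s: "(\<lambda>p. sample K n (snd (fst (fst p))) (snd (fst p)) (snd p))
        \<in> ((PD \<Otimes>\<^sub>M PZ) \<Otimes>\<^sub>M PV) \<Otimes>\<^sub>M PU \<rightarrow>\<^sub>M sample_space Z K n"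
      by (rule measurable_sample) measurable
    have sA: "sets (A (sample K n zt v u)) = sets Ws"
      using measurable_space[OF s p] by (intro sets_A) simp
    have "(\<lambda>w. return \<Omega> (m, zt, v, u, w)) \<in> Ws \<rightarrow>\<^sub>M subprob_algebra \<Omega>"
      unfolding omega_space_def using sp by measurable
    then have "F ?p = (\<integral>\<^sup>+w. \<integral>\<^sup>+\<omega>. h \<omega> \<partial>return \<Omega> (m, zt, v, u, w) \<partial>A (sample K n zt v u))"
      unfolding F_def law_given_selectors_def prod.case
      by (intro nn_integral_bind[OF h]) (simp cong: measurable_cong_sets add: sA)
    also have "\<dots> = (\<integral>\<^sup>+w. h (m, zt, v, u, w) \<partial>A (sample K n zt v u))"
      using sp sets_eq_imp_space_eq[OF sA]
      by (intro nn_integral_cong nn_integral_return h) (auto simp: omega_space_def space_pair_measure)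
    finally show ?thesis .
  qed
  have law_given_supersample_eq: "(\<integral>\<^sup>+\<omega>. h \<omega> \<partial>law_given_supersample p) = (\<integral>\<^sup>+v. \<integral>\<^sup>+u. F ((p, v), u)
    \<partial>PU \<partial>PV)"
    if p: "p \<in> space (PD \<Otimes>\<^sub>M PZ)" for p
  proof -
    have "(\<integral>\<^sup>+\<omega>. h \<omega> \<partial>law_given_supersample p) = (\<integral>\<^sup>+v. \<integral>\<^sup>+\<omega>. h \<omega> \<partial>law_given_participation (p, v) \<partial>PV)"
      unfolding law_given_supersample_def
      by (rule nn_integral_bind_kernel[OF measurable_law_given_participation measurable_const_prob[OF prob_PV] p h])
    also have "\<dots> = (\<integral>\<^sup>+v. \<integral>\<^sup>+u. F ((p, v), u) \<partial>PU \<partial>PV)"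
    proof (rule nn_integral_cong)
      fix v assume "v \<in> space PV"
      then have pv: "(p, v) \<in> space ((PD \<Otimes>\<^sub>M PZ) \<Otimes>\<^sub>M PV)" using p by (simp add: space_pair_measure)
      show "(\<integral>\<^sup>+\<omega>. h \<omega> \<partial>law_given_participation (p, v)) = (\<integral>\<^sup>+u. F ((p, v), u) \<partial>PU)"
        unfolding law_given_participation_def F_def
        by (rule nn_integral_bind_kernel[OF measurable_law_given_selectors measurable_const_prob[OF prob_PU] pv h])
    qed
    finally show ?thesis .
  qed
  have "(\<integral>\<^sup>+\<omega>. h \<omega> \<partial>fl_joint D \<mu> Z Ws A K n)
      = (\<integral>\<^sup>+m. \<integral>\<^sup>+\<omega>. h \<omega> \<partial>bind (supersample_law m) (\<lambda>zt. law_given_supersample (m, zt)) \<partial>PD)"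
    unfolding fl_joint_eq
    by (rule nn_integral_bind[OF h], rule measurable_prob_algebraD) measurable
  also have "\<dots> = (\<integral>\<^sup>+m. \<integral>\<^sup>+zt. \<integral>\<^sup>+\<omega>. h \<omega> \<partial>law_given_supersample (m, zt) \<partial>supersample_law m \<partial>PD)"
    by (intro nn_integral_cong nn_integral_bind_kernel[OF measurable_law_given_supersample measurable_supersample_law _ h])
  also have "\<dots> = (\<integral>\<^sup>+p. \<integral>\<^sup>+\<omega>. h \<omega> \<partial>law_given_supersample p \<partial>client_supersample_law)"
    by (rule nn_integral_client_supersample_law[symmetric]) measurable
  also have "\<dots> = (\<integral>\<^sup>+p. \<integral>\<^sup>+v. \<integral>\<^sup>+u. F ((p, v), u) \<partial>PU \<partial>PV \<partial>client_supersample_law)"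
    by (intro nn_integral_cong law_given_supersample_eq) (simp add: space_client_supersample_law)
  \<comment> \<open>Two exchanges carry the joint law of clients and supersample inward, past
    \<open>v\<close> here and past \<open>u\<close> next; only then is it unfolded again into
    \<open>m\<close> and \<open>zt\<close>.\<close>
  also have "\<dots> = (\<integral>\<^sup>+v. \<integral>\<^sup>+p. \<integral>\<^sup>+u. F ((p, v), u) \<partial>PU \<partial>client_supersample_law \<partial>PV)"
    by (rule VDZ.Fubini') measurable
  also have "\<dots> = (\<integral>\<^sup>+v. \<integral>\<^sup>+u. \<integral>\<^sup>+p. F ((p, v), u) \<partial>client_supersample_law \<partial>PU \<partial>PV)"
    by (intro nn_integral_cong UDZ.Fubini') measurable
  also have "\<dots> = (\<integral>\<^sup>+v. \<integral>\<^sup>+u. \<integral>\<^sup>+m. \<integral>\<^sup>+zt. F (((m, zt), v), u) \<partial>supersample_law m \<partial>PD \<partial>PU \<partial>PV)"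
    by (intro nn_integral_cong nn_integral_client_supersample_law) measurable
  also have "\<dots> = (\<integral>\<^sup>+v. \<integral>\<^sup>+u. \<integral>\<^sup>+m. \<integral>\<^sup>+zt. \<integral>\<^sup>+w. h (m, zt, v, u, w)
      \<partial>A (sample K n zt v u) \<partial>supersample_law m \<partial>PD \<partial>PU \<partial>PV)"
    by (intro nn_integral_cong F_eq) (auto simp: space_supersample_law)
  finally show ?thesis .
qed

section \<open>Unseen entries at fixed selectors\<close>

context
  fixes v u
  assumes v: "v \<in> space PV" and u: "u \<in> space PU"
begin

text \<open>The conditional law of \<open>W\<close> given the clients \<open>m\<close> at the fixed
  selectors, with the supersample integrated out.\<close>

definition hypothesis_law where "hypothesis_law m
  = bind (supersample_law m) (\<lambda>zt. A (sample K n zt v u))"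

lemma measurable_training_sample: "(\<lambda>zt. sample K n zt v u) \<in> PZ \<rightarrow>\<^sub>M sample_space Z K n"
  by (rule measurable_sample) (use v u in auto)

lemma measurable_trained_hypothesis[measurable]: "(\<lambda>zt. A (sample K n zt v u)) \<in> PZ \<rightarrow>\<^sub>M prob_algebra Ws"
  by (rule measurable_compose[OF measurable_training_sample A])

lemma measurable_hypothesis_law[measurable]: "hypothesis_law \<in> PD \<rightarrow>\<^sub>M prob_algebra Ws"
  unfolding hypothesis_law_def by (rule measurable_bind_prob_space[OF measurable_supersample_law
    measurable_trained_hypothesis])

lemma sets_supersample_law: "m \<in> space PD \<Longrightarrow> sets (supersample_law m) = sets PZ"
  using measurable_space[OF measurable_supersample_law] by (auto simp: space_prob_algebra)

lemma client_in_space: "m \<in> space PD \<Longrightarrow> i < K \<Longrightarrow> m (i, b) \<in> space D"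
  by (auto simp: space_PiM IM_def PiE_iff)

lemma prob_supersample_law_component:
  "m \<in> space PD \<Longrightarrow> x \<in> IZ K n \<Longrightarrow> prob_space (\<mu> (m (fst x, fst (snd x))))"
  by (intro prob_\<mu> client_in_space) (auto simp: IZ_def)

lemma supersample_law_eq: "supersample_law m = PiM (IZ K n) (\<lambda>x. \<mu> (m (fst x, fst (snd x))))"
  unfolding supersample_law_def case_prod_unfold ..

lemma nn_integral_hypothesis_law:
  assumes m: "m \<in> space PD" and [measurable]: "g \<in> borel_measurable Ws"
  shows "(\<integral>\<^sup>+w. g w \<partial>hypothesis_law m) = (\<integral>\<^sup>+zt. \<integral>\<^sup>+w. g w \<partial>A (sample K n zt v u) \<partial>supersample_law m)"
  unfolding hypothesis_law_def
proof (rule nn_integral_bind)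
  show "(\<lambda>zt. A (sample K n zt v u)) \<in> supersample_law m \<rightarrow>\<^sub>M subprob_algebra Ws"
    using measurable_prob_algebraD[OF measurable_trained_hypothesis]
      measurable_cong_sets[OF sets_supersample_law[OF m] refl] by blast
qed fact

text \<open>The condition on \<open>c\<close> says exactly that the entry is not a training point.
  It covers the unselected sample of a participating client as well as every sample of a
  non-participating one. In both cases the entry is, given \<open>m\<close>, independent of the
  hypothesis.\<close>

lemma nn_integral_unseen_sample:
  assumes m: "m \<in> space PD" and ij: "i < K" "j < n" and c: "\<not> (b = v i \<and> c = u (i, b, j))"
    and f[measurable]: "(\<lambda>(w, z). f w z) \<in> borel_measurable (Ws \<Otimes>\<^sub>M Z)"
  shows "(\<integral>\<^sup>+zt. \<integral>\<^sup>+w. f w (zt (i, b, j, c)) \<partial>A (sample K n zt v u) \<partial>supersample_law m)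
    = (\<integral>\<^sup>+w. \<integral>\<^sup>+z. f w z \<partial>\<mu> (m (i, b)) \<partial>hypothesis_law m)"
proof -
  let ?t = "(i, b, j, c)"
  let ?h = "\<lambda>zt. \<integral>\<^sup>+w. f w (zt ?t) \<partial>A (sample K n zt v u)"
  have t: "?t \<in> IZ K n" using ij by (simp add: IZ_def)
  have s: "m (i, b) \<in> space D" using m ij by (intro client_in_space)
  note [measurable] = measurable_component_singleton[OF t, of "\<lambda>_. Z"]
  have "?h \<in> borel_measurable PZ"
  proof (rule nn_integral_measurable_subprob_algebra2[OF _ measurable_prob_algebraD[OF
    measurable_trained_hypothesis]])
    show "(\<lambda>(zt, w). f w (zt ?t)) \<in> borel_measurable (PZ \<Otimes>\<^sub>M Ws)"
      by measurable
  qed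
  then have h: "?h \<in> borel_measurable (supersample_law m)"
    using measurable_cong_sets[OF sets_supersample_law[OF m] refl] by blast
  have "(\<integral>\<^sup>+zt. ?h zt \<partial>supersample_law m) = (\<integral>\<^sup>+zt. \<integral>\<^sup>+z. ?h (zt(?t := z)) \<partial>\<mu> (m (i, b))
    \<partial>supersample_law m)"
    using nn_integral_PiM_resample[OF finite_IZ t prob_supersample_law_component[OF m] h[unfolded supersample_law_eq]]
    by (simp add: supersample_law_eq)
  also have "\<dots> = (\<integral>\<^sup>+zt. \<integral>\<^sup>+z. \<integral>\<^sup>+w. f w z \<partial>A (sample K n zt v u) \<partial>\<mu> (m (i, b)) \<partial>supersample_law m)"
  proof -
    \<comment> \<open>The only cell that could read the overwritten entry is \<open>(i, j)\<close>;
      it reads index \<open>(i, v i, j, u (i, v i, j))\<close>, which the condition on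
      \<open>c\<close> separates from \<open>?t\<close>.\<close>
    have "sample K n (zt(?t := z)) v u = sample K n zt v u" for zt :: "_ \<Rightarrow> 'z" and z
      using c by (auto simp: sample_def fun_eq_iff restrict_def)
    then show ?thesis by simp
  qed
  also have "\<dots> = (\<integral>\<^sup>+zt. \<integral>\<^sup>+w. \<integral>\<^sup>+z. f w z \<partial>\<mu> (m (i, b)) \<partial>A (sample K n zt v u) \<partial>supersample_law m)"
  proof (rule nn_integral_cong)
    fix zt assume "zt \<in> space (supersample_law m)"
    then have zt: "zt \<in> space PZ" using sets_eq_imp_space_eq[OF sets_supersample_law[OF m]] by simp
    let ?A = "A (sample K n zt v u)"
    interpret A: prob_space ?A by (rule prob_A[OF measurable_space[OF measurable_training_sample zt]])
    interpret mu: prob_space "\<mu> (m (i, b))" by (rule prob_\<mu>[OF s])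
    interpret P: pair_sigma_finite ?A "\<mu> (m (i, b))" ..
    have "sets (?A \<Otimes>\<^sub>M \<mu> (m (i, b))) = sets (Ws \<Otimes>\<^sub>M Z)"
      by (intro sets_pair_measure_cong sets_A[OF measurable_space[OF measurable_training_sample zt]] sets_\<mu>[OF s])
    then have "(\<lambda>(w, z). f w z) \<in> borel_measurable (?A \<Otimes>\<^sub>M \<mu> (m (i, b)))"
      using f measurable_cong_sets by blast
    then show "(\<integral>\<^sup>+z. \<integral>\<^sup>+w. f w z \<partial>?A \<partial>\<mu> (m (i, b))) = (\<integral>\<^sup>+w. \<integral>\<^sup>+z. f w z \<partial>\<mu> (m (i, b)) \<partial>?A)"
      by (rule P.Fubini')
  qed
  also have "\<dots> = (\<integral>\<^sup>+w. \<integral>\<^sup>+z. f w z \<partial>\<mu> (m (i, b)) \<partial>hypothesis_law m)"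
  proof (rule nn_integral_hypothesis_law[OF m, symmetric])
    have "(\<lambda>_. \<mu> (m (i, b))) \<in> Ws \<rightarrow>\<^sub>M subprob_algebra Z"
      using measurable_space[OF measurable_prob_algebraD[OF \<mu>] s] by simp
    then show "(\<lambda>w. \<integral>\<^sup>+z. f w z \<partial>\<mu> (m (i, b))) \<in> borel_measurable Ws"
      by (rule nn_integral_measurable_subprob_algebra2[OF f])
  qed
  finally show ?thesis .
qed

text \<open>Selecting the training entries is an injective reindexing of coordinates, so their law
  is again a product. Its factors involve \<open>m\<close> only at the participating
  clients.\<close>

lemma distr_sample:
  assumes m: "m \<in> space PD"
  shows "distr (supersample_law m) (sample_space Z K n) (\<lambda>zt. sample K n zt v u)
    = PiM ({..<K} \<times> {..<n}) (\<lambda>x. \<mu> (m (fst x, v (fst x))))"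
proof -
  let ?f = "\<lambda>x. (fst x, v (fst x), snd x, u (fst x, v (fst x), snd x))"
  let ?I = "{..<K} \<times> {..<n}"
  have "distr (PiM (IZ K n) (\<lambda>x. \<mu> (m (fst x, fst (snd x)))))
       (PiM ?I (\<lambda>x. \<mu> (m (fst (?f x), fst (snd (?f x)))))) (\<lambda>\<omega>. \<lambda>x\<in>?I. \<omega> (?f x))
     = PiM ?I (\<lambda>x. \<mu> (m (fst (?f x), fst (snd (?f x)))))"
    by (rule distr_PiM_reindex[OF prob_supersample_law_component[OF m]]) (auto simp: inj_on_def IZ_def)
  moreover have "sets (PiM ?I (\<lambda>x. \<mu> (m (fst (?f x), fst (snd (?f x)))))) = sets (sample_space Z K n)"
    unfolding sample_space_def
    by (intro sets_PiM_cong refl sets_\<mu>) (auto intro!: client_in_space[OF m])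
  ultimately show ?thesis
    by (simp add: supersample_law_eq sample_def case_prod_unfold cong: distr_cong)
qed

lemma hypothesis_law_eq:
  assumes m: "m \<in> space PD"
  shows "hypothesis_law m = bind (PiM ({..<K} \<times> {..<n}) (\<lambda>x. \<mu> (m (fst x, v (fst x))))) A"
proof -
  have "(\<lambda>zt. sample K n zt v u) \<in> supersample_law m \<rightarrow>\<^sub>M sample_space Z K n"
    using measurable_training_sample measurable_cong_sets[OF sets_supersample_law[OF m] refl] by blast
  \<comment> \<open>On an empty space \<open>bind\<close> takes a default value, so nonemptiness has
    to be supplied.\<close>
  moreover have "space (supersample_law m) \<noteq> {}"
    using measurable_space[OF measurable_supersample_law m]
      by (auto simp: space_prob_algebra prob_space.not_empty)
  ultimately have "bind (distr (supersample_law m) (sample_space Z K n) (\<lambda>zt. sample K n zt v u)) A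
    = hypothesis_law m"
    unfolding hypothesis_law_def
    by (intro bind_distr[OF _ measurable_prob_algebraD[OF A]])
  then show ?thesis by (simp add: distr_sample[OF m])
qed

text \<open>In the form given by \<open>hypothesis_law_eq\<close> the law reads \<open>m\<close>
  only at indices \<open>(k, v k)\<close>, and the overwritten index is not one of them.\<close>

lemma hypothesis_law_update:
  assumes "m \<in> space PD" "i < K" "b \<noteq> v i" "c \<in> space D"
  shows "hypothesis_law (m((i, b) := c)) = hypothesis_law m"
proof -
  have "m((i, b) := c) \<in> space PD"
    using assms by (auto simp: space_PiM IM_def PiE_iff extensional_def)
  moreover have "(\<lambda>x. \<mu> ((m((i, b) := c)) (fst x, v (fst x))))
      = (\<lambda>x :: nat \<times> nat. \<mu> (m (fst x, v (fst x))))"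
    using assms by auto
  ultimately show ?thesis
    using assms(1) by (simp only: hypothesis_law_eq)
qed

text \<open>Resampling acts at two levels. The entry is first replaced by a fresh draw from client
  \<open>m (i, b)\<close>; then the client is replaced by a fresh draw from \<open>D\<close>, which
  the law of the hypothesis does not notice. On the right \<open>c\<close> is a bound client,
  unrelated to the boolean index on the left.\<close>

lemma nn_integral_unseen_client:
  assumes ij: "i < K" "j < n" and b: "b \<noteq> v i"
    and f[measurable]: "(\<lambda>(w, z). f w z) \<in> borel_measurable (Ws \<Otimes>\<^sub>M Z)"
  shows "(\<integral>\<^sup>+m. \<integral>\<^sup>+zt. \<integral>\<^sup>+w. f w (zt (i, b, j, c)) \<partial>A (sample K n zt v u) \<partial>supersample_law m \<partial>PD)
    = (\<integral>\<^sup>+m. \<integral>\<^sup>+zt. \<integral>\<^sup>+w. \<integral>\<^sup>+c. \<integral>\<^sup>+z. f w z \<partial>\<mu> c \<partial>D \<partial>A (sample K n zt v u) \<partial>supersample_law m \<partial>PD)"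
proof -
  interpret D: prob_space D by (rule prob_D)
  let ?s = "(i, b)"
  have s: "?s \<in> IM K" using ij by (simp add: IM_def)
  note [measurable] = measurable_client[OF s] measurable_prob_algebraD[OF \<mu>]
    measurable_prob_algebraD[OF measurable_hypothesis_law]
  have finite_IM: "finite (IM K)" by (simp add: IM_def)
  have inner: "(\<lambda>(w, c). \<integral>\<^sup>+z. f w z \<partial>\<mu> c) \<in> borel_measurable (Ws \<Otimes>\<^sub>M D)"
  proof -
    have "(\<lambda>p. \<integral>\<^sup>+z. f (fst p) z \<partial>\<mu> (snd p)) \<in> borel_measurable (Ws \<Otimes>\<^sub>M D)"
      by (rule nn_integral_measurable_subprob_algebra2) measurable
    then show ?thesis by (simp add: case_prod_unfold)
  qed
  have "(\<lambda>(m, w). \<integral>\<^sup>+z. f w z \<partial>\<mu> (m ?s)) \<in> borel_measurable (PD \<Otimes>\<^sub>M Ws)"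
  proof -
    have "(\<lambda>p. (snd p, fst p ?s)) \<in> PD \<Otimes>\<^sub>M Ws \<rightarrow>\<^sub>M Ws \<Otimes>\<^sub>M D" by measurable
    from measurable_compose[OF this inner] show ?thesis by (simp add: case_prod_unfold)
  qed
  then have meas: "(\<lambda>m. \<integral>\<^sup>+w. \<integral>\<^sup>+z. f w z \<partial>\<mu> (m ?s) \<partial>hypothesis_law m) \<in> borel_measurable PD"
    by (rule nn_integral_measurable_subprob_algebra2) measurable
  have "(\<integral>\<^sup>+m. \<integral>\<^sup>+zt. \<integral>\<^sup>+w. f w (zt (i, b, j, c)) \<partial>A (sample K n zt v u) \<partial>supersample_law m \<partial>PD)
      = (\<integral>\<^sup>+m. \<integral>\<^sup>+w. \<integral>\<^sup>+z. f w z \<partial>\<mu> (m ?s) \<partial>hypothesis_law m \<partial>PD)"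
    using b by (intro nn_integral_cong nn_integral_unseen_sample[OF _ ij _ f]) auto
  also have "\<dots> = (\<integral>\<^sup>+m. \<integral>\<^sup>+c. \<integral>\<^sup>+w. \<integral>\<^sup>+z. f w z \<partial>\<mu> ((m(?s := c)) ?s) \<partial>hypothesis_law (m(?s := c)) \<partial>D
    \<partial>PD)"
    by (rule nn_integral_PiM_resample[OF finite_IM s prob_D meas])
  also have "\<dots> = (\<integral>\<^sup>+m. \<integral>\<^sup>+c. \<integral>\<^sup>+w. \<integral>\<^sup>+z. f w z \<partial>\<mu> c \<partial>hypothesis_law m \<partial>D \<partial>PD)"
    by (intro nn_integral_cong) (simp add: hypothesis_law_update[OF _ ij(1) b] del: fun_upd_apply, simp)
  also have "\<dots> = (\<integral>\<^sup>+m. \<integral>\<^sup>+zt. \<integral>\<^sup>+w. \<integral>\<^sup>+c. \<integral>\<^sup>+z. f w z \<partial>\<mu> c \<partial>D \<partial>A (sample K n zt v u)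
    \<partial>supersample_law m \<partial>PD)"
  proof (rule nn_integral_cong)
    fix m assume m: "m \<in> space PD"
    have Bm: "prob_space (hypothesis_law m)" "sets (hypothesis_law m) = sets Ws"
      using measurable_space[OF measurable_hypothesis_law m] by (auto simp: space_prob_algebra)
    interpret Bm: prob_space "hypothesis_law m" by fact
    interpret P: pair_sigma_finite "hypothesis_law m" D ..
    have "(\<lambda>(w, c). \<integral>\<^sup>+z. f w z \<partial>\<mu> c) \<in> borel_measurable (hypothesis_law m \<Otimes>\<^sub>M D)"
      using inner measurable_cong_sets[OF sets_pair_measure_cong[OF Bm(2) refl] refl] by blast
    from P.Fubini'[OF this]
    have "(\<integral>\<^sup>+c. \<integral>\<^sup>+w. \<integral>\<^sup>+z. f w z \<partial>\<mu> c \<partial>hypothesis_law m \<partial>D) = (\<integral>\<^sup>+w. \<integral>\<^sup>+c. \<integral>\<^sup>+z. f w z \<partial>\<mu> c \<partial>D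
      \<partial>hypothesis_law m)" .
    also have "\<dots> = (\<integral>\<^sup>+zt. \<integral>\<^sup>+w. \<integral>\<^sup>+c. \<integral>\<^sup>+z. f w z \<partial>\<mu> c \<partial>D \<partial>A (sample K n zt v u) \<partial>supersample_law m)"
      by (rule nn_integral_hypothesis_law[OF m D.borel_measurable_nn_integral[OF inner]])
    finally show "(\<integral>\<^sup>+c. \<integral>\<^sup>+w. \<integral>\<^sup>+z. f w z \<partial>\<mu> c \<partial>hypothesis_law m \<partial>D)
        = (\<integral>\<^sup>+zt. \<integral>\<^sup>+w. \<integral>\<^sup>+c. \<integral>\<^sup>+z. f w z \<partial>\<mu> c \<partial>D \<partial>A (sample K n zt v u) \<partial>supersample_law m)" .
  qed
  finally show ?thesis .
qed

end

end

subsection \<open>Decomposition of the generalization error\<close>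

locale federated_loss = federated D \<mu> Z Ws A K n
  for D :: "'c measure" and \<mu> :: "'c \<Rightarrow> 'z measure" and Z :: "'z measure"
    and Ws :: "'w measure" and A :: "(nat \<times> nat \<Rightarrow> 'z) \<Rightarrow> 'w measure" and K n :: nat +
  fixes loss :: "'w \<Rightarrow> 'z \<Rightarrow> real"
  assumes loss_measurable[measurable]: "(\<lambda>(w, z). loss w z) \<in> borel_measurable (Ws \<Otimes>\<^sub>M Z)"
    and loss_nonneg: "0 \<le> loss w z" and loss_le_1: "loss w z \<le> 1"
    and K_pos: "0 < K" and n_pos: "0 < n"
begin

abbreviation "M \<equiv> fl_joint D \<mu> Z Ws A K n"

text \<open>Every entry of the client not selected by \<open>V\<close> is unseen. Sample 0 with the
  negated selector is the choice made in \<open>DeltaLbar\<close>, whose two terms are then this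
  loss and \<open>unseen_sample_loss i 0\<close>, in an order decided by \<open>V\<close>.\<close>

definition unseen_client_loss where
  "unseen_client_loss i \<omega> =
    loss (WOf \<omega>) (ZtOf \<omega> (i, \<not> VOf \<omega> i, 0, \<not> UOf \<omega> (i, \<not> VOf \<omega> i, 0)))"
definition unseen_sample_loss where
  "unseen_sample_loss i j \<omega> =
    loss (WOf \<omega>) (ZtOf \<omega> (i, VOf \<omega> i, j, \<not> UOf \<omega> (i, VOf \<omega> i, j)))"
definition training_loss where
  "training_loss i j \<omega> =
    loss (WOf \<omega>) (ZtOf \<omega> (i, VOf \<omega> i, j, UOf \<omega> (i, VOf \<omega> i, j)))"

lemma prob_space_M: "prob_space M" and sets_M[measurable_cong]: "sets M = sets \<Omega>"
  using fl_joint_prob_algebra by (auto simp: space_prob_algebra)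

lemma space_M: "space M = space \<Omega>"
  using sets_M by (rule sets_eq_imp_space_eq)

lemma measurable_WOf[measurable]: "WOf \<in> \<Omega> \<rightarrow>\<^sub>M Ws"
  and measurable_ZtOf: "ZtOf \<in> \<Omega> \<rightarrow>\<^sub>M PZ"
  and measurable_VOf_fun: "VOf \<in> \<Omega> \<rightarrow>\<^sub>M PV"
  and measurable_UOf_fun: "UOf \<in> \<Omega> \<rightarrow>\<^sub>M PU"
  unfolding WOf_def ZtOf_def VOf_def UOf_def omega_space_def by measurable

lemma measurable_VOf: "i < K \<Longrightarrow> (\<lambda>\<omega>. VOf \<omega> i) \<in> \<Omega> \<rightarrow>\<^sub>M count_space UNIV"
  by (rule measurable_participation[OF measurable_VOf_fun])

lemmas measurable_UOf = measurable_selector[OF measurable_UOf_fun]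

lemma measurable_loss_entry:
  assumes "f \<in> \<Omega> \<rightarrow>\<^sub>M count_space UNIV" "g \<in> \<Omega> \<rightarrow>\<^sub>M count_space UNIV" "i < K" "j < n"
  shows "(\<lambda>\<omega>. loss (WOf \<omega>) (ZtOf \<omega> (i, f \<omega>, j, g \<omega>))) \<in> borel_measurable \<Omega>"
proof -
  have [measurable]: "(\<lambda>\<omega>. ZtOf \<omega> (i, f \<omega>, j, g \<omega>)) \<in> \<Omega> \<rightarrow>\<^sub>M Z"
    by (rule measurable_supersample_entry[OF measurable_ZtOf assms])
  have "(\<lambda>\<omega>. (WOf \<omega>, ZtOf \<omega> (i, f \<omega>, j, g \<omega>))) \<in> \<Omega> \<rightarrow>\<^sub>M Ws \<Otimes>\<^sub>M Z" by measurable
  from measurable_compose[OF this loss_measurable] show ?thesis by simp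
qed

lemma measurable_losses:
  assumes "i < K" "j < n"
  shows "unseen_client_loss i \<in> borel_measurable \<Omega>"
    and "unseen_sample_loss i j \<in> borel_measurable \<Omega>"
    and "training_loss i j \<in> borel_measurable \<Omega>"
    and "DeltaLbar loss i \<in> borel_measurable \<Omega>"
    and "DeltaL loss i j \<in> borel_measurable \<Omega>"
proof -
  note V[measurable] = measurable_VOf[OF assms(1)]
  have V': "(\<lambda>\<omega>. \<not> VOf \<omega> i) \<in> \<Omega> \<rightarrow>\<^sub>M count_space UNIV" by measurable
  note [measurable] = measurable_UOf[OF V assms] measurable_UOf[OF V' assms(1) n_pos]
    measurable_UOf[OF measurable_const assms(1) n_pos]
  show "unseen_client_loss i \<in> borel_measurable \<Omega>"
    unfolding unseen_client_loss_def using assms n_pos by (intro measurable_loss_entry) measurable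
  show "unseen_sample_loss i j \<in> borel_measurable \<Omega>"
    unfolding unseen_sample_loss_def using assms by (intro measurable_loss_entry) measurable
  show "training_loss i j \<in> borel_measurable \<Omega>"
    unfolding training_loss_def using assms by (intro measurable_loss_entry) measurable
  show "DeltaLbar loss i \<in> borel_measurable \<Omega>"
    unfolding DeltaLbar_def using assms n_pos
    by (intro borel_measurable_diff measurable_loss_entry) measurable
  show "DeltaL loss i j \<in> borel_measurable \<Omega>"
    unfolding DeltaL_def using assms
    by (intro borel_measurable_diff measurable_loss_entry) measurable
qed

lemma abs_loss_diff_le: "\<bar>loss w z - loss w' z'\<bar> \<le> 1"
  using loss_nonneg[of w z] loss_le_1[of w z] loss_nonneg[of w' z'] loss_le_1[of w' z'] by simp

lemma ennreal_loss_measurable: "(\<lambda>(w, z). ennreal (loss w z)) \<in> borel_measurable (Ws \<Otimes>\<^sub>M Z)"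
  using loss_measurable by (simp add: case_prod_unfold)

text \<open>Connects the Bochner integrals in \<open>pop_risk\<close> with the nonnegative integrals
  produced by resampling; boundedness of the loss gives integrability at both levels.\<close>

lemma ennreal_pop_risk:
  assumes w: "w \<in> space Ws"
  shows "ennreal (pop_risk D \<mu> loss w) = (\<integral>\<^sup>+c. \<integral>\<^sup>+z. loss w z \<partial>\<mu> c \<partial>D)"
proof -
  interpret D: prob_space D by (rule prob_D)
  have lw: "loss w \<in> borel_measurable Z"
    using measurable_compose[OF measurable_Pair1'[OF w] loss_measurable] by simp
  have int: "integrable (\<mu> c) (loss w)" and le: "(\<integral>z. loss w z \<partial>\<mu> c) \<le> 1"
    if c: "c \<in> space D" for c
  proof -
    interpret mu: prob_space "\<mu> c" by (rule prob_\<mu>[OF c])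
    show "integrable (\<mu> c) (loss w)"
      using lw measurable_cong_sets[OF sets_\<mu>[OF c] refl]
      by (intro mu.integrable_const_bound[of _ 1]) (auto simp: loss_nonneg loss_le_1)
    then show "(\<integral>z. loss w z \<partial>\<mu> c) \<le> 1"
      by (intro mu.integral_le_const) (auto simp: loss_le_1)
  qed
  have "(\<lambda>c. \<integral>z. loss w z \<partial>\<mu> c) \<in> borel_measurable D"
    by (rule measurable_compose[OF
      measurable_prob_algebraD[OF \<mu>] integral_measurable_subprob_algebra[OF lw]])
  then have "integrable D (\<lambda>c. \<integral>z. loss w z \<partial>\<mu> c)"
    by (intro D.integrable_const_bound[of _ 1])
      (auto simp: le integral_nonneg_AE loss_nonneg intro!: AE_I2)
  then have "ennreal (pop_risk D \<mu> loss w) = (\<integral>\<^sup>+c. ennreal (\<integral>z. loss w z \<partial>\<mu> c) \<partial>D)"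
    unfolding pop_risk_def
    by (intro nn_integral_eq_integral[symmetric]) (auto simp: integral_nonneg_AE loss_nonneg)
  also have "\<dots> = (\<integral>\<^sup>+c. \<integral>\<^sup>+z. loss w z \<partial>\<mu> c \<partial>D)"
    by (intro nn_integral_cong nn_integral_eq_integral[symmetric] int) (auto simp: loss_nonneg)
  finally show ?thesis .
qed

lemma pop_risk_nonneg: "0 \<le> pop_risk D \<mu> loss w"
  unfolding pop_risk_def by (intro integral_nonneg_AE AE_I2 loss_nonneg)

lemma measurable_nn_pop_risk:
  "(\<lambda>w. \<integral>\<^sup>+c. \<integral>\<^sup>+z. loss w z \<partial>\<mu> c \<partial>D) \<in> borel_measurable Ws"
proof -
  interpret D: prob_space D by (rule prob_D)
  note [measurable] = measurable_prob_algebraD[OF \<mu>] ennreal_loss_measurable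
  have "(\<lambda>p. \<integral>\<^sup>+z. ennreal (loss (fst p) z) \<partial>\<mu> (snd p)) \<in> borel_measurable (Ws \<Otimes>\<^sub>M D)"
    by (rule nn_integral_measurable_subprob_algebra2) measurable
  then show ?thesis
    by (intro D.borel_measurable_nn_integral) (simp add: case_prod_unfold)
qed

lemma measurable_pop_risk: "pop_risk D \<mu> loss \<in> borel_measurable Ws"
proof -
  have "(\<lambda>w. enn2real (\<integral>\<^sup>+c. \<integral>\<^sup>+z. loss w z \<partial>\<mu> c \<partial>D)) \<in> borel_measurable Ws"
    using measurable_nn_pop_risk by measurable
  then show ?thesis
    by (subst measurable_cong[of _ _ "\<lambda>w. enn2real (\<integral>\<^sup>+c. \<integral>\<^sup>+z. loss w z \<partial>\<mu> c \<partial>D)"])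
      (simp_all add: ennreal_pop_risk[symmetric] pop_risk_nonneg)
qed

text \<open>For nonnegative measurable functions the Bochner integral is \<open>enn2real\<close> of
  the nonnegative one, so equality transfers directly.\<close>

lemma integral_M_eqI:
  fixes X Y :: "('c, 'z, 'w) omega \<Rightarrow> real"
  assumes "X \<in> borel_measurable \<Omega>" "Y \<in> borel_measurable \<Omega>"
    and "\<And>\<omega>. 0 \<le> X \<omega>" "\<And>\<omega>. 0 \<le> Y \<omega>"
    and "(\<integral>\<^sup>+\<omega>. X \<omega> \<partial>M) = (\<integral>\<^sup>+\<omega>. Y \<omega> \<partial>M)"
  shows "(\<integral>\<omega>. X \<omega> \<partial>M) = (\<integral>\<omega>. Y \<omega> \<partial>M)"
proof -
  have "X \<in> borel_measurable M" "Y \<in> borel_measurable M"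
    using assms measurable_cong_sets[OF sets_M refl] by blast+
  then show ?thesis using assms by (simp add: integral_eq_nn_integral)
qed

section \<open>Expected losses on unseen entries\<close>

lemma expectation_unseen_client_loss:
  assumes i: "i < K"
  shows "(\<integral>\<omega>. unseen_client_loss i \<omega> \<partial>M) = (\<integral>\<omega>. pop_risk D \<mu> loss (WOf \<omega>) \<partial>M)"
proof (rule integral_M_eqI)
  let ?p = "\<lambda>w. \<integral>\<^sup>+c. \<integral>\<^sup>+z. loss w z \<partial>\<mu> c \<partial>D"
  show meas: "unseen_client_loss i \<in> borel_measurable \<Omega>" by (rule measurable_losses[OF i n_pos])
  show "(\<lambda>\<omega>. pop_risk D \<mu> loss (WOf \<omega>)) \<in> borel_measurable \<Omega>"
    by (rule measurable_compose[OF measurable_WOf measurable_pop_risk])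
  have "(\<integral>\<^sup>+\<omega>. unseen_client_loss i \<omega> \<partial>M)
      = (\<integral>\<^sup>+v. \<integral>\<^sup>+u. \<integral>\<^sup>+m. \<integral>\<^sup>+zt. \<integral>\<^sup>+w. unseen_client_loss i (m, zt, v, u, w)
          \<partial>A (sample K n zt v u) \<partial>supersample_law m \<partial>PD \<partial>PU \<partial>PV)"
    using meas by (intro nn_integral_fl_joint) measurable
  also have "\<dots> = (\<integral>\<^sup>+v. \<integral>\<^sup>+u. \<integral>\<^sup>+m. \<integral>\<^sup>+zt. \<integral>\<^sup>+w. ?p w
          \<partial>A (sample K n zt v u) \<partial>supersample_law m \<partial>PD \<partial>PU \<partial>PV)"
  proof (rule nn_integral_cong, rule nn_integral_cong)
    fix v u assume vu: "v \<in> space PV" "u \<in> space PU"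
    show "(\<integral>\<^sup>+m. \<integral>\<^sup>+zt. \<integral>\<^sup>+w. unseen_client_loss i (m, zt, v, u, w) \<partial>A (sample K n zt v u)
      \<partial>supersample_law m \<partial>PD)
        = (\<integral>\<^sup>+m. \<integral>\<^sup>+zt. \<integral>\<^sup>+w. ?p w \<partial>A (sample K n zt v u) \<partial>supersample_law m \<partial>PD)"
      using nn_integral_unseen_client[OF vu i n_pos _ ennreal_loss_measurable,
          of "\<not> v i" "\<not> u (i, \<not> v i, 0)"]
      by (simp add: unseen_client_loss_def WOf_def ZtOf_def VOf_def UOf_def)
  qed
  also have "\<dots> = (\<integral>\<^sup>+\<omega>. ?p (WOf \<omega>) \<partial>M)"
    by (subst nn_integral_fl_joint[OF measurable_compose[OF measurable_WOf measurable_nn_pop_risk]])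
      (simp add: WOf_def)
  also have "\<dots> = (\<integral>\<^sup>+\<omega>. pop_risk D \<mu> loss (WOf \<omega>) \<partial>M)"
    using measurable_space[OF measurable_WOf]
    by (intro nn_integral_cong) (simp add: ennreal_pop_risk space_M)
  finally show "(\<integral>\<^sup>+\<omega>. unseen_client_loss i \<omega> \<partial>M) = (\<integral>\<^sup>+\<omega>. pop_risk D \<mu> loss (WOf \<omega>) \<partial>M)" .
qed (auto simp: unseen_client_loss_def loss_nonneg pop_risk_nonneg)

text \<open>Given clients and coins, the unseen sample is a fresh draw from
  \<open>\<mu> (m (i, v i))\<close>, and no \<open>j\<close> survives in the resulting integral.
  Hence the level at sample 0 can serve as intermediate term for all \<open>j\<close>.\<close>

lemma expectation_unseen_sample_loss:
  assumes i: "i < K" and j: "j < n" and j': "j' < n"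
  shows "(\<integral>\<omega>. unseen_sample_loss i j \<omega> \<partial>M) = (\<integral>\<omega>. unseen_sample_loss i j' \<omega> \<partial>M)"
proof -
  have *: "(\<integral>\<^sup>+\<omega>. unseen_sample_loss i j \<omega> \<partial>M)
      = (\<integral>\<^sup>+v. \<integral>\<^sup>+u. \<integral>\<^sup>+m. \<integral>\<^sup>+w. \<integral>\<^sup>+z. loss w z \<partial>\<mu> (m (i, v i)) \<partial>hypothesis_law v u m \<partial>PD \<partial>PU \<partial>PV)"
    if j: "j < n" for j
  proof -
    note meas = measurable_losses(2)[OF i j]
    have "(\<integral>\<^sup>+\<omega>. unseen_sample_loss i j \<omega> \<partial>M)
      = (\<integral>\<^sup>+v. \<integral>\<^sup>+u. \<integral>\<^sup>+m. \<integral>\<^sup>+zt. \<integral>\<^sup>+w. unseen_sample_loss i j (m, zt, v, u, w)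
          \<partial>A (sample K n zt v u) \<partial>supersample_law m \<partial>PD \<partial>PU \<partial>PV)"
      using meas by (intro nn_integral_fl_joint) measurable
    also have "\<dots> = (\<integral>\<^sup>+v. \<integral>\<^sup>+u. \<integral>\<^sup>+m. \<integral>\<^sup>+w. \<integral>\<^sup>+z. loss w z
        \<partial>\<mu> (m (i, v i)) \<partial>hypothesis_law v u m \<partial>PD \<partial>PU \<partial>PV)"
    proof (intro nn_integral_cong)
      fix v u m assume vu: "v \<in> space PV" "u \<in> space PU" and m: "m \<in> space PD"
      show "(\<integral>\<^sup>+zt. \<integral>\<^sup>+w. unseen_sample_loss i j (m, zt, v, u, w) \<partial>A (sample K n zt v u)
        \<partial>supersample_law m)
          = (\<integral>\<^sup>+w. \<integral>\<^sup>+z. loss w z \<partial>\<mu> (m (i, v i)) \<partial>hypothesis_law v u m)"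
        using nn_integral_unseen_sample[OF vu m i j _ ennreal_loss_measurable,
            of "v i" "\<not> u (i, v i, j)"]
        by (simp add: unseen_sample_loss_def WOf_def ZtOf_def VOf_def UOf_def)
    qed
    finally show ?thesis .
  qed
  show ?thesis
  proof (rule integral_M_eqI)
    show "(\<integral>\<^sup>+\<omega>. unseen_sample_loss i j \<omega> \<partial>M) = (\<integral>\<^sup>+\<omega>. unseen_sample_loss i j' \<omega> \<partial>M)"
      unfolding *[OF j] *[OF j'] ..
  qed (simp_all add: measurable_losses i j j', simp_all add: unseen_sample_loss_def loss_nonneg)
qed

text \<open>The index of the selector depends on \<open>V\<close>, but on the event
  \<open>V = a\<close> it is the fixed coordinate \<open>(i, a, j)\<close>, which is independent of
  \<open>V\<close>. The probability thus factors into two coin faces.\<close>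

lemma prob_VOf_UOf:
  assumes i: "i < K" and j: "j < n"
  shows "measure M {\<omega> \<in> space M. VOf \<omega> i = a \<and> UOf \<omega> (i, VOf \<omega> i, j) = b} = 1 / 4"
proof -
  interpret M: prob_space M by (rule prob_space_M)
  note V[measurable] = measurable_VOf[OF i]
  note [measurable] = measurable_UOf[OF V i j] measurable_UOf[OF measurable_const i j]
  let ?h = "\<lambda>\<omega>. indicator {a} (VOf \<omega> i) * indicator {b} (UOf \<omega> (i, a, j)) :: ennreal"
  have V': "(\<lambda>\<omega>. indicator {a} (VOf \<omega> i) :: ennreal) \<in> borel_measurable \<Omega>"
    by (rule measurable_compose[OF V]) simp
  have U': "(\<lambda>\<omega>. indicator {b} (UOf \<omega> (i, a, j)) :: ennreal) \<in> borel_measurable \<Omega>"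
    by (rule measurable_compose[OF measurable_UOf[OF measurable_const i j]]) simp_all
  have "emeasure M {\<omega> \<in> space M. VOf \<omega> i = a \<and> UOf \<omega> (i, VOf \<omega> i, j) = b}
      = (\<integral>\<^sup>+\<omega>. indicator {\<omega> \<in> space M. VOf \<omega> i = a \<and> UOf \<omega> (i, VOf \<omega> i, j) = b} \<omega> \<partial>M)"
    by (rule nn_integral_indicator[symmetric]) measurable
  also have "\<dots> = (\<integral>\<^sup>+\<omega>. ?h \<omega> \<partial>M)"
    by (intro nn_integral_cong) (auto split: split_indicator)
  also have "\<dots> = (\<integral>\<^sup>+v. \<integral>\<^sup>+u. \<integral>\<^sup>+m. \<integral>\<^sup>+zt. \<integral>\<^sup>+w. ?h (m, zt, v, u, w)
          \<partial>A (sample K n zt v u) \<partial>supersample_law m \<partial>PD \<partial>PU \<partial>PV)"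
    by (rule nn_integral_fl_joint[OF borel_measurable_times_ennreal[OF V' U']])
  also have "\<dots> = (\<integral>\<^sup>+v. \<integral>\<^sup>+u. indicator {a} (v i) * indicator {b} (u (i, a, j)) \<partial>PU \<partial>PV)"
  proof (intro nn_integral_cong)
    fix v u assume vu: "v \<in> space PV" "u \<in> space PU"
    let ?k = "indicator {a} (v i) * indicator {b} (u (i, a, j)) :: ennreal"
    have "(\<integral>\<^sup>+m. \<integral>\<^sup>+zt. \<integral>\<^sup>+w. ?k \<partial>A (sample K n zt v u) \<partial>supersample_law m \<partial>PD)
        = (\<integral>\<^sup>+m. \<integral>\<^sup>+w. ?k \<partial>hypothesis_law v u m \<partial>PD)"
      by (intro nn_integral_cong nn_integral_hypothesis_law[symmetric] vu) auto
    also have "\<dots> = (\<integral>\<^sup>+m. ?k \<partial>PD)"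
    proof (rule nn_integral_cong)
      fix m assume "m \<in> space PD"
      then interpret prob_space "hypothesis_law v u m"
        using measurable_space[OF measurable_hypothesis_law[OF vu]] by (auto simp: space_prob_algebra)
      show "(\<integral>\<^sup>+w. ?k \<partial>hypothesis_law v u m) = ?k" by (simp add: emeasure_space_1)
    qed
    also have "\<dots> = ?k"
      using prob_space.emeasure_space_1[OF prob_PD] by simp
    finally show "(\<integral>\<^sup>+m. \<integral>\<^sup>+zt. \<integral>\<^sup>+w. ?h (m, zt, v, u, w) \<partial>A (sample K n zt v u) \<partial>supersample_law m
      \<partial>PD) = ?k"
      by (simp add: VOf_def UOf_def)
  qed
  also have "\<dots> = ennreal (1 / 2) * ennreal (1 / 2)"
  proof -
    have u: "(\<lambda>u. indicator {b} (u (i, a, j)) :: ennreal) \<in> borel_measurable PU"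
      by (rule measurable_compose[OF
            measurable_selector[OF measurable_ident_sets[OF refl] measurable_const i j]]) simp_all
    have v: "(\<lambda>v. indicator {a} (v i) :: ennreal) \<in> borel_measurable PV"
      by (rule measurable_compose[OF measurable_participation[OF measurable_ident_sets[OF refl] i]]) simp
    have fin: "finite (IU K n)" "(i, a, j) \<in> IU K n" using i j by (auto simp: IU_def)
    have fin': "finite {..<K}" "i \<in> {..<K}" using i by auto
    show ?thesis
      unfolding nn_integral_cmult[OF u] nn_integral_PiM_coin_indicator[OF fin]
        nn_integral_multc[OF v] nn_integral_PiM_coin_indicator[OF fin'] ..
  qed
  also have "\<dots> = ennreal (1 / 4)"
    by (subst ennreal_mult''[symmetric]) auto
  finally show ?thesis
    by (simp add: M.emeasure_eq_measure)
qed

lemma prob_VOf: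
  assumes i: "i < K"
  shows "measure M {\<omega> \<in> space M. VOf \<omega> i} = 1 / 2"
proof -
  interpret M: prob_space M by (rule prob_space_M)
  note V[measurable] = measurable_VOf[OF i]
  note [measurable] = measurable_UOf[OF V i n_pos]
  let ?E = "\<lambda>b. {\<omega> \<in> space M. VOf \<omega> i = True \<and> UOf \<omega> (i, VOf \<omega> i, 0) = b}"
  have "{\<omega> \<in> space M. VOf \<omega> i} = ?E True \<union> ?E False" by auto
  then have "measure M {\<omega> \<in> space M. VOf \<omega> i} = measure M (?E True) + measure M (?E False)"
    by (simp only:) (intro M.finite_measure_Union, measurable, auto)
  then show ?thesis by (simp only: prob_VOf_UOf[OF i n_pos])
qed

lemma gen_error_eq:
  "gen_error D \<mu> Z Ws A loss K n =
    (1 / real K) * (\<Sum>i<K. \<integral>\<omega>. unseen_client_loss i \<omega> - unseen_sample_loss i 0 \<omega> \<partial>M)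
    + (1 / (real K * real n)) * (\<Sum>i<K. \<Sum>j<n. \<integral>\<omega>. unseen_sample_loss i j \<omega> - training_loss i j \<omega> \<partial>M)"
proof -
  interpret M: prob_space M by (rule prob_space_M)
  let ?p = "\<integral>\<omega>. pop_risk D \<mu> loss (WOf \<omega>) \<partial>M"
  let ?a = "\<lambda>i. \<integral>\<omega>. unseen_sample_loss i 0 \<omega> \<partial>M"
  let ?s = "\<lambda>i j. \<integral>\<omega>. training_loss i j \<omega> \<partial>M"
  have int: "integrable M f" if "f \<in> borel_measurable \<Omega>" "\<And>\<omega>. 0 \<le> f \<omega> \<and> f \<omega> \<le> 1"
    for f :: "('c, 'z, 'w) omega \<Rightarrow> real"
    using that measurable_cong_sets[OF sets_M refl]
    by (intro M.integrable_const_bound[of _ 1]) auto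
  have int_losses: "integrable M (unseen_client_loss i)" "integrable M (unseen_sample_loss i j)"
    "integrable M (training_loss i j)" if "i < K" "j < n" for i j
    using int[OF measurable_losses(1)[OF that]] int[OF measurable_losses(2)[OF that]]
      int[OF measurable_losses(3)[OF that]]
    by (simp_all
      add: unseen_client_loss_def unseen_sample_loss_def training_loss_def loss_nonneg loss_le_1)
  have client: "(\<integral>\<omega>. unseen_client_loss i \<omega> - unseen_sample_loss i 0 \<omega> \<partial>M) = ?p - ?a i" if "i < K" for i
    using int_losses[OF that n_pos] expectation_unseen_client_loss[OF that] by simp
  have sample: "(\<integral>\<omega>. unseen_sample_loss i j \<omega> - training_loss i j \<omega> \<partial>M) = ?a i - ?s i j"
    if "i < K" "j < n" for i j
    using int_losses[OF that] expectation_unseen_sample_loss[OF that n_pos] by simp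
  have "(\<integral>\<omega>. (\<Sum>i<K. \<Sum>j<n. training_loss i j \<omega>) \<partial>M)
      = (\<Sum>i<K. \<integral>\<omega>. (\<Sum>j<n. training_loss i j \<omega>) \<partial>M)"
    using int_losses(3)
      by (intro Bochner_Integration.integral_sum Bochner_Integration.integrable_sum) auto
  also have "\<dots> = (\<Sum>i<K. \<Sum>j<n. ?s i j)"
    using int_losses(3) by (intro sum.cong refl Bochner_Integration.integral_sum) auto
  finally have sum_training: "(\<integral>\<omega>. (\<Sum>i<K. \<Sum>j<n. training_loss i j \<omega>) \<partial>M)
      = (\<Sum>i<K. \<Sum>j<n. ?s i j)" .
  have "emp_risk K n loss (sample K n (ZtOf \<omega>) (VOf \<omega>) (UOf \<omega>)) (WOf \<omega>)
      = (1 / (real K * real n)) * (\<Sum>i<K. \<Sum>j<n. training_loss i j \<omega>)" for \<omega> :: "('c, 'z, 'w) omega"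
    unfolding emp_risk_def
    by (intro arg_cong2[where f = "(*)"] sum.cong refl) (simp add: sample_def training_loss_def)
  then have emp: "(\<integral>\<omega>. emp_risk K n loss (sample K n (ZtOf \<omega>) (VOf \<omega>) (UOf \<omega>)) (WOf \<omega>) \<partial>M)
      = (1 / (real K * real n)) * (\<Sum>i<K. \<Sum>j<n. ?s i j)"
    using sum_training by simp
  have "gen_error D \<mu> Z Ws A loss K n = ?p - (1 / (real K * real n)) * (\<Sum>i<K. \<Sum>j<n. ?s i j)"
    unfolding gen_error_def Let_def emp ..
  \<comment> \<open>The intermediate terms cancel: \<open>?a i\<close> does not depend on
    \<open>j\<close>, so summing it over the \<open>n\<close> samples and dividing by
    \<open>K * n\<close> gives the same as dividing it by \<open>K\<close>.\<close>
  also have "\<dots> = (1 / real K) * (\<Sum>i<K. ?p - ?a i)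
      + (1 / (real K * real n)) * (\<Sum>i<K. \<Sum>j<n. ?a i - ?s i j)"
    using K_pos n_pos
    by (simp add: sum_subtractf sum_distrib_left[symmetric] right_diff_distrib)
  also have "\<dots> = (1 / real K) * (\<Sum>i<K. \<integral>\<omega>. unseen_client_loss i \<omega> - unseen_sample_loss i 0 \<omega> \<partial>M)
    + (1 / (real K * real n)) * (\<Sum>i<K. \<Sum>j<n. \<integral>\<omega>. unseen_sample_loss i j \<omega> - training_loss i j \<omega> \<partial>M)"
    by (simp add: client sample)
  finally show ?thesis .
qed

section \<open>Bounds for the two gaps\<close>

lemma participation_gap_le:
  assumes i: "i < K"
  shows "\<bar>\<integral>\<omega>. unseen_client_loss i \<omega> - unseen_sample_loss i 0 \<omega> \<partial>M\<bar>
    \<le> sqrt (2 * MI_real_bool M (DeltaLbar loss i) (\<lambda>\<omega>. VOf \<omega> i))"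
proof -
  interpret M: prob_space M by (rule prob_space_M)
  \<comment> \<open>If \<open>V\<close> is True the unseen client is \<open>(i, False)\<close>,
    whose loss is the subtracted term of \<open>DeltaLbar\<close>; hence the minus sign in that
    case.\<close>
  have "unseen_client_loss i \<omega> - unseen_sample_loss i 0 \<omega>
      = (if VOf \<omega> i then - DeltaLbar loss i \<omega> else DeltaLbar loss i \<omega>)" for \<omega> :: "('c, 'z, 'w) omega"
    by (simp add: unseen_client_loss_def unseen_sample_loss_def DeltaLbar_def)
  moreover have "\<bar>M.expectation (\<lambda>\<omega>. if VOf \<omega> i then - DeltaLbar loss i \<omega> else DeltaLbar loss i \<omega>)\<bar>
      \<le> sqrt (2 * MI_real_bool M (DeltaLbar loss i) (\<lambda>\<omega>. VOf \<omega> i))"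
  proof (rule M.abs_signed_expectation_le_mutual_information)
    show "DeltaLbar loss i \<in> borel_measurable M"
      using measurable_losses(4)[OF i n_pos] measurable_cong_sets[OF sets_M refl] by blast
    show "(\<lambda>\<omega>. VOf \<omega> i) \<in> M \<rightarrow>\<^sub>M count_space UNIV"
      using measurable_VOf[OF i] measurable_cong_sets[OF sets_M refl] by blast
  qed (simp_all add: prob_VOf[OF i] DeltaLbar_def abs_loss_diff_le)
  ultimately show ?thesis by simp
qed

text \<open>The signing coin is the selector of the client that \<open>V\<close> picks, and
  \<open>DeltaL\<close> looks at that same client. Working under the conditional law given
  \<open>V\<close> therefore compares the two samples of one fixed client.\<close>

lemma out_of_sample_gap_le:
  assumes i: "i < K" and j: "j < n"
  shows "\<bar>\<integral>\<omega>. unseen_sample_loss i j \<omega> - training_loss i j \<omega> \<partial>M\<bar>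
    \<le> (\<integral>v. sqrt (2 * disint_MI_real_bool M (DeltaL loss i j)
            (\<lambda>\<omega>. UOf \<omega> (i, VOf \<omega> i, j)) (\<lambda>\<omega>. VOf \<omega> i) v)
          \<partial>distr M (count_space UNIV) (\<lambda>\<omega>. VOf \<omega> i))"
proof -
  interpret M: prob_space M by (rule prob_space_M)
  let ?U = "\<lambda>\<omega>. UOf \<omega> (i, VOf \<omega> i, j)"
  note V = measurable_VOf[OF i]
  have "unseen_sample_loss i j \<omega> - training_loss i j \<omega>
      = (if ?U \<omega> then - DeltaL loss i j \<omega> else DeltaL loss i j \<omega>)" for \<omega> :: "('c, 'z, 'w) omega"
    by (simp add: training_loss_def unseen_sample_loss_def DeltaL_def)
  moreover have "\<bar>M.expectation (\<lambda>\<omega>. if ?U \<omega> then - DeltaL loss i j \<omega> else DeltaL loss i j \<omega>)\<bar>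
      \<le> (\<integral>v. sqrt (2 * disint_MI_real_bool M (DeltaL loss i j) ?U (\<lambda>\<omega>. VOf \<omega> i) v)
          \<partial>distr M (count_space UNIV) (\<lambda>\<omega>. VOf \<omega> i))"
  proof (rule M.abs_signed_expectation_le_disintegrated_mutual_information)
    show "DeltaL loss i j \<in> borel_measurable M"
      using measurable_losses(5)[OF i j] measurable_cong_sets[OF sets_M refl] by blast
    show "(\<lambda>\<omega>. VOf \<omega> i) \<in> M \<rightarrow>\<^sub>M count_space UNIV"
      using V measurable_cong_sets[OF sets_M refl] by blast
    show "?U \<in> M \<rightarrow>\<^sub>M count_space UNIV"
      using measurable_UOf[OF V i j] measurable_cong_sets[OF sets_M refl] by blast
  qed (simp_all add: prob_VOf_UOf[OF i j] DeltaL_def abs_loss_diff_le)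
  ultimately show ?thesis by simp
qed

end

theorem mainTheorem14:
  fixes D :: "'c measure" and \<mu> :: "'c \<Rightarrow> 'z measure" and Z :: "'z measure"
    and Ws :: "'w measure" and A :: "(nat \<times> nat \<Rightarrow> 'z) \<Rightarrow> 'w measure"
    and loss :: "'w \<Rightarrow> 'z \<Rightarrow> real" and K n :: nat
  assumes "prob_space D"
    and "\<mu> \<in> measurable D (prob_algebra Z)"
    and "A \<in> measurable (sample_space Z K n) (prob_algebra Ws)"
    and "(\<lambda>(w, z). loss w z) \<in> borel_measurable (Ws \<Otimes>\<^sub>M Z)"
    and "\<And>w z. 0 \<le> loss w z \<and> loss w z \<le> 1"
    and "0 < K" and "0 < n"
  shows "let M = fl_joint D \<mu> Z Ws A K n in
    \<bar>gen_error D \<mu> Z Ws A loss K n\<bar>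
      \<le> (1 / real K) * (\<Sum>i<K. sqrt (2 * MI_real_bool M (DeltaLbar loss i) (\<lambda>\<omega>. VOf \<omega> i)))
        + (1 / (real K * real n)) * (\<Sum>i<K. \<Sum>j<n.
            \<integral>v. sqrt (2 * disint_MI_real_bool M (DeltaL loss i j)
                        (\<lambda>\<omega>. UOf \<omega> (i, VOf \<omega> i, j)) (\<lambda>\<omega>. VOf \<omega> i) v)
              \<partial>(distr M (count_space UNIV) (\<lambda>\<omega>. VOf \<omega> i)))"
proof -
  interpret federated_loss D \<mu> Z Ws A K n loss
  proof (intro federated_loss.intro federated.intro federated_loss_axioms.intro)
    show "0 \<le> loss w z" and "loss w z \<le> 1" for w z using assms(5)[of w z] by auto
  qed fact+
  let ?C = "\<lambda>i. \<integral>\<omega>. unseen_client_loss i \<omega> - unseen_sample_loss i 0 \<omega> \<partial>M"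
  let ?S = "\<lambda>i j. \<integral>\<omega>. unseen_sample_loss i j \<omega> - training_loss i j \<omega> \<partial>M"
  have "\<bar>gen_error D \<mu> Z Ws A loss K n\<bar>
      \<le> \<bar>(1 / real K) * (\<Sum>i<K. ?C i)\<bar> + \<bar>(1 / (real K * real n)) * (\<Sum>i<K. \<Sum>j<n. ?S i j)\<bar>"
    unfolding gen_error_eq by (rule abs_triangle_ineq)
  also have "\<dots> = (1 / real K) * \<bar>\<Sum>i<K. ?C i\<bar> + (1 / (real K * real n)) * \<bar>\<Sum>i<K. \<Sum>j<n. ?S i j\<bar>"
    by (simp add: abs_mult)
  also have "\<dots> \<le> (1 / real K) * (\<Sum>i<K. \<bar>?C i\<bar>) + (1 / (real K * real n)) * (\<Sum>i<K. \<Sum>j<n. \<bar>?S i j\<bar>)"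
  proof (intro add_mono mult_left_mono sum_abs)
    have "\<bar>\<Sum>i<K. \<Sum>j<n. ?S i j\<bar> \<le> (\<Sum>i<K. \<bar>\<Sum>j<n. ?S i j\<bar>)" by (rule sum_abs)
    also have "\<dots> \<le> (\<Sum>i<K. \<Sum>j<n. \<bar>?S i j\<bar>)" by (intro sum_mono sum_abs)
    finally show "\<bar>\<Sum>i<K. \<Sum>j<n. ?S i j\<bar> \<le> (\<Sum>i<K. \<Sum>j<n. \<bar>?S i j\<bar>)" .
  qed simp_all
  also have "\<dots> \<le> (1 / real K) * (\<Sum>i<K. sqrt (2 * MI_real_bool M (DeltaLbar loss i) (\<lambda>\<omega>. VOf \<omega> i)))
        + (1 / (real K * real n)) * (\<Sum>i<K. \<Sum>j<n.
            \<integral>v. sqrt (2 * disint_MI_real_bool M (DeltaL loss i j)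
                        (\<lambda>\<omega>. UOf \<omega> (i, VOf \<omega> i, j)) (\<lambda>\<omega>. VOf \<omega> i) v)
              \<partial>(distr M (count_space UNIV) (\<lambda>\<omega>. VOf \<omega> i)))"
    by (intro add_mono mult_left_mono sum_mono participation_gap_le out_of_sample_gap_le) auto
  finally show ?thesis unfolding Let_def .
qed

end
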